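(* Let $\gamma$ be a closed strong spacelike curve in the 3-dimensional Lorentz space $\mathbb{R}^3_1$ with index $1$. Then its total curvature satisfies $\int_\gamma k\,\mathrm{d}s\leq 2\pi$. Equality holds if and only if $\gamma$ is a convex curve lying on a spacelike plane.
   Context: $\mathbb{R}^3_1$ is $\mathbb{R}^3$ with the Lorentz inner product $\langle X,Y\rangle=x_1y_1+x_2y_2-x_3y_3$. A vector $X$ is spacelike if $\langle X,X\rangle>0$; a linear subspace is spacelike if $\langle\cdot,\cdot\rangle$ restricts to a positive definite form on it; an affine plane is spacelike if its direction subspace is. A curve is spacelike if its tangent line at each point is spacelike; it then has an arc-length parameter $s$ with unit tangent vector $T=\gamma'(s)$, $\langle T,T\rangle=1$. A strong spacelike curve is a (smooth, regular) spacelike curve such that at each point the curvature vector $T'(s)$ is nonzero and the osculating plane, i.e. the plane spanned by $T$ and $T'(s)$, is a spacelike 2-plane. Since $\langle T,T'\rangle=0$, $T'$ is then spacelike, and one writes $T'(s)=kN$ with $\langle N,N\rangle=1$ and curvature $k=\sqrt{\langle T',T'\rangle}>0$. A closed curve means a smoothly closed (periodic) one. The total curvature is $\int_\gamma k\,\mathrm{d}s$, the integral over one period. The de Sitter sphere is $\mathbb{S}^2_1=\{X\in\mathbb{R}^3_1:\langle X,X\rangle=1\}$, parametrized by latitude and longitude as $(\cosh\varphi\cos\theta,\cosh\varphi\sin\theta,\sinh\varphi)$. The tangent indicatrix of $\gamma$ is the closed curve $s\mapsto T(s)\in\mathbb{S}^2_1$. The index $I$ of $\gamma$ is the winding number of the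 tangent indicatrix around $\mathbb{S}^2_1$ (which is homotopy equivalent to a circle), i.e. $\frac{1}{2\pi}$ times the total change of a continuous choice of the longitude $\theta$ along $T$ over one period; it is an integer, and $\gamma$ is always oriented so that it is positive. *)

theory Defs
  imports "HOL-Analysis.Analysis"
begin

definition lorentz :: "real^3 \<Rightarrow> real^3 \<Rightarrow> real" where
  "lorentz X Y = X$1 * Y$1 + X$2 * Y$2 - X$3 * Y$3"

definition spacelike_subspace :: "(real^3) set \<Rightarrow> bool" where
  "spacelike_subspace W \<longleftrightarrow> subspace W \<and> (\<forall>X\<in>W. X \<noteq> 0 \<longrightarrow> lorentz X X > 0)"

definition direction :: "(real^3) set \<Rightarrow> (real^3) set" where
  "direction A = {X - Y | X Y. X \<in> A \<and> Y \<in> A}"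

definition spacelike_plane :: "(real^3) set \<Rightarrow> bool" where
  "spacelike_plane A \<longleftrightarrow> affine A \<and> aff_dim A = 2 \<and> spacelike_subspace (direction A)"

definition velocity :: "(real \<Rightarrow> real^3) \<Rightarrow> real \<Rightarrow> real^3" where
  "velocity \<gamma> t = vector_derivative \<gamma> (at t)"

definition smooth_curve :: "(real \<Rightarrow> real^3) \<Rightarrow> bool" where
  "smooth_curve \<gamma> \<longleftrightarrow> (\<forall>n t. (velocity ^^ n) \<gamma> differentiable (at t))"

definition spacelike_curve :: "(real \<Rightarrow> real^3) \<Rightarrow> bool" where
  "spacelike_curve \<gamma> \<longleftrightarrow> smooth_curve \<gamma> \<and>
     (\<forall>t. velocity \<gamma> t \<noteq> 0 \<and> spacelike_subspace (span {velocity \<gamma> t}))"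

text \<open>Curves carry an arbitrary regular parameter \<open>t\<close>. Differentiation with respect to the
  arc length \<open>s\<close> of \<open>\<gamma>\<close> is expressed through \<open>ds = speed \<gamma> t dt\<close>.\<close>

definition speed :: "(real \<Rightarrow> real^3) \<Rightarrow> real \<Rightarrow> real" where
  "speed \<gamma> t = sqrt (lorentz (velocity \<gamma> t) (velocity \<gamma> t))"

definition arclength_deriv :: "(real \<Rightarrow> real^3) \<Rightarrow> (real \<Rightarrow> real^3) \<Rightarrow> real \<Rightarrow> real^3" where
  "arclength_deriv \<gamma> f t = (1 / speed \<gamma> t) *\<^sub>R vector_derivative f (at t)"

definition unit_tangent :: "(real \<Rightarrow> real^3) \<Rightarrow> real \<Rightarrow> real^3" where
  "unit_tangent \<gamma> = arclength_deriv \<gamma> \<gamma>"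

definition curvature_vector :: "(real \<Rightarrow> real^3) \<Rightarrow> real \<Rightarrow> real^3" where
  "curvature_vector \<gamma> = arclength_deriv \<gamma> (unit_tangent \<gamma>)"

definition osculating_plane :: "(real \<Rightarrow> real^3) \<Rightarrow> real \<Rightarrow> (real^3) set" where
  "osculating_plane \<gamma> t = span {unit_tangent \<gamma> t, curvature_vector \<gamma> t}"

definition strong_spacelike_curve :: "(real \<Rightarrow> real^3) \<Rightarrow> bool" where
  "strong_spacelike_curve \<gamma> \<longleftrightarrow> spacelike_curve \<gamma> \<and>
     (\<forall>t. curvature_vector \<gamma> t \<noteq> 0 \<and>
          dim (osculating_plane \<gamma> t) = 2 \<and> spacelike_subspace (osculating_plane \<gamma> t))"

definition closed_curve :: "(real \<Rightarrow> real^3) \<Rightarrow> real \<Rightarrow> bool" where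
  "closed_curve \<gamma> P \<longleftrightarrow> P > 0 \<and> (\<forall>t. \<gamma> (t + P) = \<gamma> t)"

definition curvature :: "(real \<Rightarrow> real^3) \<Rightarrow> real \<Rightarrow> real" where
  "curvature \<gamma> t = sqrt (lorentz (curvature_vector \<gamma> t) (curvature_vector \<gamma> t))"

definition total_curvature :: "(real \<Rightarrow> real^3) \<Rightarrow> real \<Rightarrow> real" where
  "total_curvature \<gamma> P = integral {0..P} (\<lambda>t. curvature \<gamma> t * speed \<gamma> t)"

definition de_sitter_point :: "real \<Rightarrow> real \<Rightarrow> real^3" where
  "de_sitter_point \<phi> \<theta> = vector [cosh \<phi> * cos \<theta>, cosh \<phi> * sin \<theta>, sinh \<phi>]"

text \<open>Relational form of ``the index of \<open>\<gamma>\<close> over one period \<open>P\<close> is \<open>n\<close>''. Any two continuous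
  longitudes along the tangent indicatrix differ by a constant, so \<open>n\<close> is unique.\<close>

definition has_index :: "(real \<Rightarrow> real^3) \<Rightarrow> real \<Rightarrow> int \<Rightarrow> bool" where
  "has_index \<gamma> P n \<longleftrightarrow>
     (\<exists>\<theta>. continuous_on {0..P} \<theta> \<and>
          (\<forall>t\<in>{0..P}. \<exists>\<phi>. unit_tangent \<gamma> t = de_sitter_point \<phi> (\<theta> t)) \<and>
          (\<theta> P - \<theta> 0) / (2 * pi) = of_int n)"

text \<open>Within a spacelike plane \<open>A\<close>, the line through \<open>\<gamma> t\<close> tangent to \<open>\<gamma>\<close> has a normal vector
  \<open>\<nu>\<close> in the direction subspace of \<open>A\<close>; convexity of the closed curve means that it is simple
  and lies in one of the two closed half-planes of \<open>A\<close> cut out by each of its tangent lines.\<close>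

definition convex_curve_in :: "(real^3) set \<Rightarrow> (real \<Rightarrow> real^3) \<Rightarrow> real \<Rightarrow> bool" where
  "convex_curve_in A \<gamma> P \<longleftrightarrow>
     range \<gamma> \<subseteq> A \<and> inj_on \<gamma> {0..<P} \<and>
     (\<forall>t. \<exists>\<nu>\<in>direction A. \<nu> \<noteq> 0 \<and> lorentz \<nu> (velocity \<gamma> t) = 0 \<and>
          (\<forall>u. lorentz \<nu> (\<gamma> u - \<gamma> t) \<ge> 0))"

end

theory Submission
  imports Defs
begin

text \<open>
  The total curvature is the length of the tangent indicatrix \<open>T\<close>, a closed spacelike curve on the
  de Sitter sphere. With the longitude \<open>\<theta>\<close> and the conformal latitude \<open>\<psi>\<close>, spacelike means
  \<open>\<bar>d\<psi>\<bar> < d\<theta>\<close>, so for index 1 any two of its points are spacelike related.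

  For a point \<open>p\<close> of the sphere put \<open>u = \<langle>p, T\<rangle>\<close>. The Gram determinant of \<open>p, T, T'\<close> gives
  \<open>u'\<^sup>2 = \<bar>T'\<bar>\<^sup>2 (1 - u\<^sup>2) + det (p, T, T')\<^sup>2\<close>; hence \<open>\<bar>d (arccos u)\<bar> \<ge> \<bar>T'\<bar> ds\<close> as long as
  \<open>\<bar>u\<bar> < 1\<close>, which bounds the length of an arc by the \<open>arccos\<close> of the product of its end points.

  As \<open>\<gamma>\<close> is closed, \<open>0\<close> lies in the convex hull of \<open>T\<close>, and as \<open>T\<close> is connected it is a nonnegative
  combination of three points of \<open>T\<close>. They cut \<open>T\<close> into arcs whose bounds add up to at most \<open>2\<pi>\<close>.
  In the case of equality all determinants vanish and \<open>T\<close> lies in an osculating plane.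
\<close>

subsection \<open>Derivatives and periodic functions\<close>

lemma has_real_derivative_component:
  fixes f :: "real \<Rightarrow> real^'n"
  assumes "(f has_vector_derivative f') (at t)"
  shows "((\<lambda>t. f t $ i) has_real_derivative f' $ i) (at t)"
  using bounded_linear.has_vector_derivative[OF bounded_linear_vec_nth assms]
  by (simp add: has_real_derivative_iff_has_vector_derivative)

lemma antiderivative_exists:
  fixes f :: "real \<Rightarrow> real"
  assumes "continuous_on UNIV f"
  obtains F where "\<And>t. (F has_real_derivative f t) (at t)"
  using einterval_antiderivative[of "-\<infinity>" \<infinity> f] assms
  by (auto simp: continuous_on_eq_continuous_at has_real_derivative_iff_has_vector_derivative)

lemma has_vector_derivative_periodic:
  fixes f :: "real \<Rightarrow> 'a :: real_normed_vector"
  assumes deriv: "\<And>t. (f has_vector_derivative f' t) (at t)" and per: "\<And>t. f (t + P) = f t"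
  shows "f' (t + P) = f' t"
proof -
  have "((\<lambda>t. t + P) has_vector_derivative 1) (at t)"
    by (auto intro!: derivative_eq_intros)
  from vector_diff_chain_at[OF this deriv] have "((\<lambda>t. f (t + P)) has_vector_derivative f' (t + P)) (at t)"
    by (simp add: o_def)
  then show ?thesis
    unfolding per using deriv vector_derivative_unique_at by blast
qed

text \<open>The window may start anywhere, because later arguments cut the loop at a point of their
  own choice.\<close>

lemma periodic_reduce:
  fixes f :: "real \<Rightarrow> 'a" and P :: real
  assumes "P > 0" and per: "\<And>t. f (t + P) = f t"
  obtains s where "s \<in> {a..<a + P}" "f t = f s"
proof -
  interpret periodic_fun_simple f P by standard (rule per)
  define k where "k = \<lfloor>(t - a) / P\<rfloor>"
  define s where "s = t - of_int k * P"
  have "of_int k \<le> (t - a) / P" "(t - a) / P < of_int k + 1" unfolding k_def by linarith+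
  then have "s \<in> {a..<a + P}"
    using \<open>P > 0\<close> by (simp add: s_def field_simps)
  moreover have "f t = f s"
    unfolding s_def by (rule minus_of_int[symmetric])
  ultimately show ?thesis using that by blast
qed

subsection \<open>Lorentz geometry\<close>

lemma lorentz_commute: "lorentz X Y = lorentz Y X"
  by (simp add: lorentz_def algebra_simps)

lemma lorentz_add_right: "lorentz X (Y + Z) = lorentz X Y + lorentz X Z"
  by (simp add: lorentz_def algebra_simps)

lemma lorentz_diff_right: "lorentz X (Y - Z) = lorentz X Y - lorentz X Z"
  by (simp add: lorentz_def algebra_simps)

lemma lorentz_scaleR_right: "lorentz X (c *\<^sub>R Y) = c * lorentz X Y"
  by (simp add: lorentz_def algebra_simps)

lemma lorentz_scaleR_left: "lorentz (c *\<^sub>R X) Y = c * lorentz X Y"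
  by (simp add: lorentz_def algebra_simps)

lemma lorentz_minus_left: "lorentz (- X) Y = - lorentz X Y"
  by (simp add: lorentz_def algebra_simps)

lemma lorentz_minus_right: "lorentz X (- Y) = - lorentz X Y"
  by (simp add: lorentz_def algebra_simps)

lemma lorentz_0_right: "lorentz X 0 = 0"
  by (simp add: lorentz_def)

lemma lorentz_has_real_derivative:
  assumes "(f has_vector_derivative f') (at t)" "(g has_vector_derivative g') (at t)"
  shows "((\<lambda>t. lorentz (f t) (g t)) has_real_derivative lorentz f' (g t) + lorentz (f t) g') (at t)"
  unfolding lorentz_def
  by (auto intro!: derivative_eq_intros has_real_derivative_component[OF assms(1)]
      has_real_derivative_component[OF assms(2)] simp: algebra_simps)

lemma lorentz_const_has_real_derivative:
  assumes "(f has_vector_derivative f') (at t)"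
  shows "((\<lambda>t. lorentz p (f t)) has_real_derivative lorentz p f') (at t)"
  using lorentz_has_real_derivative[OF has_vector_derivative_const[of p] assms]
  by (simp add: lorentz_def)

lemma lorentz_orthogonal_derivative:
  assumes deriv: "(f has_vector_derivative f') (at t)" and const: "\<And>t. lorentz (f t) (f t) = c"
  shows "lorentz (f t) f' = 0"
proof -
  have "((\<lambda>t. lorentz (f t) (f t)) has_real_derivative lorentz f' (f t) + lorentz (f t) f') (at t)"
    by (intro lorentz_has_real_derivative deriv)
  then have "lorentz f' (f t) + lorentz (f t) f' = 0"
    using DERIV_unique[OF DERIV_const] unfolding const by metis
  then show ?thesis by (simp add: lorentz_commute[of f'])
qed

lemma continuous_on_lorentz [continuous_intros]:
  "continuous_on S f \<Longrightarrow> continuous_on S g \<Longrightarrow> continuous_on S (\<lambda>t. lorentz (f t) (g t))"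
  unfolding lorentz_def by (intro continuous_intros)

text \<open>The right-hand side is minus the Gram determinant of \<open>p\<close>, \<open>x\<close>,
  \<open>y\<close>. The sign is the determinant -1 of the Lorentz form.\<close>

lemma lorentz_gram:
  "(p \<bullet> cross3 x y)\<^sup>2 =
     lorentz p p * (lorentz x y)\<^sup>2 + lorentz x x * (lorentz p y)\<^sup>2 + lorentz y y * (lorentz p x)\<^sup>2
     - lorentz p p * lorentz x x * lorentz y y - 2 * lorentz p x * lorentz x y * lorentz p y"
  by (simp add: lorentz_def cross3_def inner_vec_def sum_3 power2_eq_square algebra_simps)

text \<open>The form evaluated on the cross product is minus the Gram determinant of
  \<open>x\<close> and \<open>y\<close>. The Euclidean cross product serves as normal vector because
  planes are written with the Euclidean inner product.\<close>

lemma cross3_nonzero_if_gram: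
  assumes "lorentz x x * lorentz y y \<noteq> (lorentz x y)\<^sup>2"
  shows "cross3 x y \<noteq> 0"
proof
  assume "cross3 x y = 0"
  moreover have "lorentz (cross3 x y) (cross3 x y) = (lorentz x y)\<^sup>2 - lorentz x x * lorentz y y"
    by (simp add: lorentz_def cross3_def power2_eq_square algebra_simps)
  ultimately show False
    using assms by (simp add: lorentz_0_right)
qed

lemma orthogonal_imp_multiple_cross3:
  assumes "cross3 a b \<noteq> 0" "n \<bullet> a = 0" "n \<bullet> b = 0"
  obtains k where "n = k *\<^sub>R cross3 a b"
proof -
  let ?c = "cross3 a b"
  have "cross3 n ?c = 0"
    using assms by (simp add: Lagrange)
  then have "(?c \<bullet> ?c) *\<^sub>R n = (?c \<bullet> n) *\<^sub>R ?c"
    using Lagrange[of ?c n ?c] by simp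
  then have "(1 / (?c \<bullet> ?c)) *\<^sub>R (?c \<bullet> ?c) *\<^sub>R n = (1 / (?c \<bullet> ?c)) *\<^sub>R (?c \<bullet> n) *\<^sub>R ?c"
    by simp
  then show ?thesis using that assms(1) by simp
qed

text \<open>Both \<open>n\<close> and \<open>m\<close> are multiples of \<open>cross3 a b\<close>,
  and the factor of \<open>m\<close> is not zero, so \<open>x\<close> is orthogonal to
  \<open>cross3 a b\<close> as well.\<close>

lemma inner_eq_0_if_coplanar:
  fixes a b n m x :: "real^3"
  assumes "cross3 a b \<noteq> 0" "m \<noteq> 0" "n \<bullet> a = 0" "n \<bullet> b = 0" "m \<bullet> a = 0" "m \<bullet> b = 0" "m \<bullet> x = 0"
  shows "n \<bullet> x = 0"
proof -
  obtain k where k: "n = k *\<^sub>R cross3 a b"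
    using orthogonal_imp_multiple_cross3 assms by metis
  obtain l where l: "m = l *\<^sub>R cross3 a b"
    using orthogonal_imp_multiple_cross3 assms by metis
  from l assms show ?thesis by (auto simp: k)
qed

lemma cramer3:
  fixes x p q r :: "real^3"
  shows "(p \<bullet> cross3 q r) *\<^sub>R x =
    (x \<bullet> cross3 q r) *\<^sub>R p + (p \<bullet> cross3 x r) *\<^sub>R q + (p \<bullet> cross3 q x) *\<^sub>R r"
  by (simp add: vec_eq_iff forall_3 cross3_def inner_vec_def sum_3 algebra_simps)

text \<open>Expanding \<open>n\<close> itself in \<open>a\<close>, \<open>b\<close>,
  \<open>c\<close> by Cramer's rule and pairing with \<open>n\<close> leaves the triple product
  times \<open>n \<bullet> n\<close> on one side and zero on the other.\<close>

lemma cross3_triple_eq_0: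
  fixes n a b c :: "real^3"
  assumes "n \<noteq> 0" "n \<bullet> a = 0" "n \<bullet> b = 0" "n \<bullet> c = 0"
  shows "a \<bullet> cross3 b c = 0"
  using arg_cong[OF cramer3[of a b c n], of "\<lambda>x. n \<bullet> x"] assms by (simp add: inner_add_right)

lemma hyperplane_eq_span:
  fixes n x y :: "real^3"
  assumes "n \<noteq> 0" "n \<bullet> x = 0" "n \<bullet> y = 0" "dim (span {x, y}) = 2"
  shows "{z. n \<bullet> z = 0} = span {x, y}"
proof -
  have "span {x, y} = {z. n \<bullet> z = 0}"
  proof (rule subspace_dim_equal)
    show "span {x, y} \<subseteq> {z. n \<bullet> z = 0}"
      using assms by (intro span_minimal subspace_hyperplane) auto
    show "dim {z. n \<bullet> z = 0} \<le> dim (span {x, y})"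
      using assms dim_hyperplane[OF assms(1)] by simp
  qed (simp_all add: subspace_hyperplane)
  then show ?thesis by simp
qed

lemma direction_hyperplane: "direction {x. n \<bullet> x = b} = {x. n \<bullet> x = 0}" if "n \<bullet> a = b"
proof (intro set_eqI iffI)
  fix x assume "x \<in> {x. n \<bullet> x = 0}"
  then have "a + x \<in> {x. n \<bullet> x = b}" "a \<in> {x. n \<bullet> x = b}" "x = (a + x) - a"
    using that by (auto simp: inner_add_right)
  then show "x \<in> direction {x. n \<bullet> x = b}"
    unfolding direction_def by blast
qed (auto simp: direction_def inner_diff_right)

subsection \<open>Three points of a connected set\<close>

text \<open>The refinement of Caratheodory's theorem due to Fenchel and Bunt: connectedness saves
  one of the four points. If \<open>p\<close>, \<open>q\<close>, \<open>r\<close> are dependent, a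
  linear relation removes a point; otherwise an intermediate value argument replaces one. A positive
  sum of coefficients takes the place of sum 1, so nothing has to be normalised.\<close>

lemma zero_combination_of_three_if_four:
  fixes S :: "(real^3) set"
  assumes "connected S" and S: "p \<in> S" "q \<in> S" "r \<in> S" "x \<in> S"
    and nonneg: "a \<ge> 0" "b \<ge> 0" "c \<ge> 0" "d \<ge> 0" "a + b + c + d > 0"
    and zero: "a *\<^sub>R p + b *\<^sub>R q + c *\<^sub>R r + d *\<^sub>R x = 0"
  shows "\<exists>p\<in>S. \<exists>q\<in>S. \<exists>r\<in>S. \<exists>a b c. a \<ge> 0 \<and> b \<ge> 0 \<and> c \<ge> 0 \<and> a + b + c > 0 \<and>
           a *\<^sub>R p + b *\<^sub>R q + c *\<^sub>R r = (0 :: real^3)" (is ?thesis)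
proof -
  have I: ?thesis if "p \<in> S" "q \<in> S" "r \<in> S" "a \<ge> 0" "b \<ge> 0" "c \<ge> 0" "a + b + c > 0"
    "a *\<^sub>R p + b *\<^sub>R q + c *\<^sub>R r = 0" for p q r a b c
    using that by blast
  let ?D = "p \<bullet> cross3 q r"
  consider "a = 0 \<or> b = 0 \<or> c = 0 \<or> d = 0" | "a > 0" "b > 0" "c > 0" "d > 0" "?D = 0"
    | "a > 0" "b > 0" "c > 0" "d > 0" "?D \<noteq> 0"
    using nonneg by fastforce
  then show ?thesis
  proof cases
    case 1
    then show ?thesis
      using I[of q r x b c d] I[of p r x a c d] I[of p q x a b d] I[of p q r a b c]
        nonneg S zero by auto
  next
    case 2
    \<comment> \<open>A kernel vector of the matrix with columns \<open>p\<close>, \<open>q\<close>,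
      \<open>r\<close>; its sign is chosen so that some coefficient is positive.\<close>
    obtain e f g where efg: "e *\<^sub>R p + f *\<^sub>R q + g *\<^sub>R r = 0" "e > 0 \<or> f > 0 \<or> g > 0"
    proof -
      define A :: "real^3^3" where "A = transpose (vector [p, q, r])"
      have "det A = 0"
        using 2 by (simp add: A_def dot_cross_det)
      then have "\<not> invertible A"
        by (simp only: invertible_det_nz)
      then have "\<not> (\<forall>y. A *v y = 0 \<longrightarrow> y = 0)"
        by (simp only: invertible_left_inverse matrix_left_invertible_ker) simp
      then obtain y where y: "y \<noteq> 0" "A *v y = 0"
        by blast
      have "y $ 1 *\<^sub>R p + y $ 2 *\<^sub>R q + y $ 3 *\<^sub>R r = A *v y"
        by (simp add: A_def vec_eq_iff matrix_vector_mult_def transpose_def sum_3 mult.commute)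
      with y have *: "y $ 1 *\<^sub>R p + y $ 2 *\<^sub>R q + y $ 3 *\<^sub>R r = 0" by simp
      moreover from * have "(- y $ 1) *\<^sub>R p + (- y $ 2) *\<^sub>R q + (- y $ 3) *\<^sub>R r = 0"
        by (simp add: vec_eq_iff) (smt (verit))
      moreover have "y $ 1 \<noteq> 0 \<or> y $ 2 \<noteq> 0 \<or> y $ 3 \<noteq> 0"
        using y(1) by (auto simp: vec_eq_iff forall_3)
      ultimately show ?thesis
        using that[of "y $ 1" "y $ 2" "y $ 3"] that[of "- y $ 1" "- y $ 2" "- y $ 3"] by linarith
    qed
    \<comment> \<open>Subtracting \<open>1 / M\<close> times the relation cancels the coefficient
      with the largest ratio and keeps the other two nonnegative, while \<open>d\<close> stays
      positive.\<close>
    define M where "M = max (e / a) (max (f / b) (g / c))"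
    have "M > 0"
      using efg 2 by (auto simp: M_def less_max_iff_disj)
    have ge: "a - e / M \<ge> 0" "b - f / M \<ge> 0" "c - g / M \<ge> 0"
    proof -
      have "e / a \<le> M" "f / b \<le> M" "g / c \<le> M" by (auto simp: M_def)
      then show "a - e / M \<ge> 0" "b - f / M \<ge> 0" "c - g / M \<ge> 0"
        using \<open>M > 0\<close> 2 by (auto simp: field_simps)
    qed
    have "M = e / a \<or> M = f / b \<or> M = g / c" by (auto simp: M_def max_def)
    then have z: "a - e / M = 0 \<or> b - f / M = 0 \<or> c - g / M = 0"
      using 2 \<open>M > 0\<close> by (auto simp: field_simps)
    have "(a - e / M) *\<^sub>R p + (b - f / M) *\<^sub>R q + (c - g / M) *\<^sub>R r + d *\<^sub>R x
        = (a *\<^sub>R p + b *\<^sub>R q + c *\<^sub>R r + d *\<^sub>R x) - (1 / M) *\<^sub>R (e *\<^sub>R p + f *\<^sub>R q + g *\<^sub>R r)"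
      by (simp add: algebra_simps)
    then have "(a - e / M) *\<^sub>R p + (b - f / M) *\<^sub>R q + (c - g / M) *\<^sub>R r + d *\<^sub>R x = 0"
      using zero efg by simp
    with z ge 2 S show ?thesis
      using I[of q r x "b - f / M" "c - g / M" d] I[of p r x "a - e / M" "c - g / M" d]
        I[of p q x "a - e / M" "b - f / M" d] by fastforce
  next
    case 3
    txt \<open>On the way from \<open>x\<close> to \<open>p\<close> the largest coordinate with respect to \<open>p, q, r\<close> changes sign;
      where it vanishes, the point and two of \<open>p, q, r\<close> balance.\<close>
    define \<mu>\<^sub>1 \<mu>\<^sub>2 \<mu>\<^sub>3 where
      "\<mu>\<^sub>1 y = y \<bullet> cross3 q r / ?D" and "\<mu>\<^sub>2 y = p \<bullet> cross3 y r / ?D" and "\<mu>\<^sub>3 y = p \<bullet> cross3 q y / ?D"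
      for y :: "real^3"
    have coords: "y = \<mu>\<^sub>1 y *\<^sub>R p + \<mu>\<^sub>2 y *\<^sub>R q + \<mu>\<^sub>3 y *\<^sub>R r" for y
    proof -
      have "y = (1 / ?D) *\<^sub>R ?D *\<^sub>R y" using 3 by simp
      also have "\<dots> = (1 / ?D) *\<^sub>R ((y \<bullet> cross3 q r) *\<^sub>R p + (p \<bullet> cross3 y r) *\<^sub>R q + (p \<bullet> cross3 q y) *\<^sub>R r)"
        by (simp only: cramer3[of p q r y])
      finally show ?thesis
        by (simp add: \<mu>\<^sub>1_def \<mu>\<^sub>2_def \<mu>\<^sub>3_def scaleR_add_right)
    qed
    define m where "m y = max (\<mu>\<^sub>1 y) (max (\<mu>\<^sub>2 y) (\<mu>\<^sub>3 y))" for y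
    \<comment> \<open>Cramer's rule applied to the balanced relation: \<open>x\<close> has the
      coordinates \<open>- a / d\<close>, \<open>- b / d\<close>, \<open>- c / d\<close>, all
      negative.\<close>
    have "a * ?D + d * (x \<bullet> cross3 q r) = (a *\<^sub>R p + b *\<^sub>R q + c *\<^sub>R r + d *\<^sub>R x) \<bullet> cross3 q r"
      "b * ?D + d * (p \<bullet> cross3 x r) = p \<bullet> cross3 (a *\<^sub>R p + b *\<^sub>R q + c *\<^sub>R r + d *\<^sub>R x) r"
      "c * ?D + d * (p \<bullet> cross3 q x) = p \<bullet> cross3 q (a *\<^sub>R p + b *\<^sub>R q + c *\<^sub>R r + d *\<^sub>R x)"
      by (simp_all add: cross3_def inner_vec_def sum_3 algebra_simps)
    then have "\<mu>\<^sub>1 x = - a / d" "\<mu>\<^sub>2 x = - b / d" "\<mu>\<^sub>3 x = - c / d"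
      unfolding zero \<mu>\<^sub>1_def \<mu>\<^sub>2_def \<mu>\<^sub>3_def using 3 by (simp_all add: field_simps)
    then have "m x < 0" using 3 by (simp add: m_def)
    moreover have "m p > 0" using 3 by (simp add: m_def \<mu>\<^sub>1_def less_max_iff_disj)
    moreover have "continuous_on S m"
      unfolding m_def \<mu>\<^sub>1_def \<mu>\<^sub>2_def \<mu>\<^sub>3_def by (intro continuous_intros continuous_on_cross) (use 3 in auto)
    then have "connected (m ` S)" using \<open>connected S\<close> by (rule connected_continuous_image)
    ultimately have "0 \<in> m ` S"
      using S unfolding connected_iff_interval by (meson imageI less_imp_le)
    then obtain y where y: "y \<in> S" "m y = 0" by auto
    then have le: "\<mu>\<^sub>1 y \<le> 0" "\<mu>\<^sub>2 y \<le> 0" "\<mu>\<^sub>3 y \<le> 0" and z: "\<mu>\<^sub>1 y = 0 \<or> \<mu>\<^sub>2 y = 0 \<or> \<mu>\<^sub>3 y = 0"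
      unfolding m_def by (auto simp: max_def split: if_splits)
    have "(- \<mu>\<^sub>1 y) *\<^sub>R p + (- \<mu>\<^sub>2 y) *\<^sub>R q + (- \<mu>\<^sub>3 y) *\<^sub>R r + 1 *\<^sub>R y
        = y - (\<mu>\<^sub>1 y *\<^sub>R p + \<mu>\<^sub>2 y *\<^sub>R q + \<mu>\<^sub>3 y *\<^sub>R r)"
      by (simp add: algebra_simps)
    also have "\<dots> = 0" using coords[of y] by (metis cancel_comm_monoid_add_class.diff_cancel)
    finally have comb: "(- \<mu>\<^sub>1 y) *\<^sub>R p + (- \<mu>\<^sub>2 y) *\<^sub>R q + (- \<mu>\<^sub>3 y) *\<^sub>R r + 1 *\<^sub>R y = 0" .
    from z show ?thesis
    proof (elim disjE)
      assume "\<mu>\<^sub>1 y = 0"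
      then show ?thesis using I[of q r y "- \<mu>\<^sub>2 y" "- \<mu>\<^sub>3 y" 1] S y(1) le comb by simp
    next
      assume "\<mu>\<^sub>2 y = 0"
      then show ?thesis using I[of p r y "- \<mu>\<^sub>1 y" "- \<mu>\<^sub>3 y" 1] S y(1) le comb by simp
    next
      assume "\<mu>\<^sub>3 y = 0"
      then show ?thesis using I[of p q y "- \<mu>\<^sub>1 y" "- \<mu>\<^sub>2 y" 1] S y(1) le comb by simp
    qed
  qed
qed

text \<open>Caratheodory leaves at most four points. Smaller sets are padded with repeated points of
  coefficient 0, so that the preceding lemma covers every size.\<close>

lemma zero_combination_of_three:
  fixes S :: "(real^3) set"
  assumes "connected S" "0 \<in> convex hull S"
  shows "\<exists>p\<in>S. \<exists>q\<in>S. \<exists>r\<in>S. \<exists>a b c. a \<ge> 0 \<and> b \<ge> 0 \<and> c \<ge> 0 \<and> a + b + c > 0 \<and>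
           a *\<^sub>R p + b *\<^sub>R q + c *\<^sub>R r = (0 :: real^3)"
proof -
  obtain V u where V: "finite V" "V \<subseteq> S" "card V \<le> 4" "\<forall>x\<in>V. 0 \<le> u x" "sum u V = 1"
    "(\<Sum>v\<in>V. u v *\<^sub>R v) = 0"
    using assms(2) unfolding convex_hull_caratheodory by auto
  consider "card V = 0" | "card V = 1" | "card V = 2" | "card V = 3" | "card V = 4"
    using V(3) by linarith
  then show ?thesis
  proof cases
    case 1
    then show ?thesis using V by simp
  next
    case 2
    then obtain p where "V = {p}" by (auto simp: card_1_singleton_iff)
    then show ?thesis
      using V zero_combination_of_three_if_four[OF assms(1), of p p p p "u p" 0 0 0] by auto
  next
    case 3
    then obtain p q where "V = {p, q}" "p \<noteq> q" by (auto simp: card_2_iff)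
    then show ?thesis
      using V zero_combination_of_three_if_four[OF assms(1), of p q p p "u p" "u q" 0 0] by auto
  next
    case 4
    then obtain p q r where "V = {p, q, r}" "p \<noteq> q" "q \<noteq> r" "p \<noteq> r" by (auto simp: card_3_iff)
    then show ?thesis
      using V zero_combination_of_three_if_four[OF assms(1), of p q r p "u p" "u q" "u r" 0]
      by (auto simp: add.assoc)
  next
    case 5
    then obtain p q r x where "V = {p, q, r, x}" "distinct [p, q, r, x]"
      by (auto simp: card_Suc_eq numeral_eq_Suc)
    then show ?thesis
      using V zero_combination_of_three_if_four[OF assms(1), of p q r x "u p" "u q" "u r" "u x"]
      by (auto simp: add.assoc)
  qed
qed

subsection \<open>Spacelike loops on the de Sitter sphere\<close>

text \<open>Here \<open>v\<close> is a speed and \<open>G\<close> its antiderivative. The identity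
  gives \<open>- u' t \<ge> v t * sqrt (1 - (u t)\<^sup>2)\<close>, so
  \<open>arccos (u t) - G t\<close> is nondecreasing; it is stationary exactly where
  \<open>d\<close> vanishes. The end points may have \<open>\<bar>u\<bar> = 1\<close>, where arccos
  is continuous but not differentiable, so derivatives are taken in the open interval only.\<close>

lemma length_le_arccos_diff_neg:
  fixes u u' v d G :: "real \<Rightarrow> real"
  assumes "a < b"
    and u: "\<And>t. (u has_real_derivative u' t) (at t)"
    and G: "\<And>t. (G has_real_derivative v t) (at t)"
    and v: "\<And>t. v t > 0"
    and cont: "continuous_on {a..b} u'" "continuous_on {a..b} v" "continuous_on {a..b} d"
    and eq: "\<And>t. (u' t)\<^sup>2 = (v t)\<^sup>2 * (1 - (u t)\<^sup>2) + (d t)\<^sup>2"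
    and bound: "\<And>t. t \<in> {a<..<b} \<Longrightarrow> \<bar>u t\<bar> < 1"
    and ends: "\<bar>u a\<bar> \<le> 1" "\<bar>u b\<bar> \<le> 1"
    and neg: "\<And>t. t \<in> {a<..<b} \<Longrightarrow> u' t < 0"
  shows "G b - G a \<le> arccos (u b) - arccos (u a)"
    and "G b - G a = arccos (u b) - arccos (u a) \<longleftrightarrow> (\<forall>t\<in>{a..b}. d t = 0)"
proof -
  let ?D = "\<lambda>t. arccos (u t) - G t"
  let ?D' = "\<lambda>t. - u' t / sqrt (1 - (u t)\<^sup>2) - v t"
  have contu: "continuous_on S u" and contG: "continuous_on S G" for S
    by (meson DERIV_continuous_on u G has_field_derivative_at_within)+
  have bound': "\<bar>u t\<bar> \<le> 1" if "t \<in> {a..b}" for t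
    using bound[of t] ends that by (cases "t = a \<or> t = b") auto
  have contD: "continuous_on {a..b} ?D"
    by (intro continuous_intros contu contG) (use bound' in \<open>force simp: abs_le_iff\<close>)
  have s: "1 - (u t)\<^sup>2 > 0" if "t \<in> {a<..<b}" for t
    using bound[OF that] by (simp add: abs_square_less_1)
  have D: "(?D has_real_derivative ?D' t) (at t)" if "t \<in> {a<..<b}" for t
    using bound[OF that]
    by (auto intro!: derivative_eq_intros u G DERIV_chain2[OF DERIV_arccos] simp: divide_simps)
  have uu: "- u' t = sqrt ((v t)\<^sup>2 * (1 - (u t)\<^sup>2) + (d t)\<^sup>2)" if "t \<in> {a<..<b}" for t
    using neg[OF that] by (subst eq[symmetric]) simp
  have ge: "?D' t \<ge> 0" if "t \<in> {a<..<b}" for t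
  proof -
    have "v t * sqrt (1 - (u t)\<^sup>2) = sqrt ((v t)\<^sup>2 * (1 - (u t)\<^sup>2))"
      using v[of t] by (simp add: real_sqrt_mult)
    also have "\<dots> \<le> - u' t"
      unfolding uu[OF that] by simp
    finally show ?thesis
      using s[OF that] by (simp add: field_simps)
  qed
  have iff0: "?D' t = 0 \<longleftrightarrow> d t = 0" if "t \<in> {a<..<b}" for t
  proof -
    have "?D' t = 0 \<longleftrightarrow> - u' t = v t * sqrt (1 - (u t)\<^sup>2)"
      using s[OF that] by (auto simp add: field_simps)
    also have "v t * sqrt (1 - (u t)\<^sup>2) = sqrt ((v t)\<^sup>2 * (1 - (u t)\<^sup>2))"
      using v[of t] by (simp add: real_sqrt_mult)
    finally show ?thesis
      unfolding uu[OF that] by simp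
  qed
  have mono: "?D x \<le> ?D y" if "a \<le> x" "x \<le> y" "y \<le> b" for x y
  proof (cases "x = y")
    case False
    have "\<exists>y. (?D has_real_derivative y) (at z) \<and> y \<ge> 0" if "x < z" "z < y" for z
      using that D[of z] ge[of z] \<open>a \<le> x\<close> \<open>y \<le> b\<close> by force
    then show ?thesis
      using DERIV_nonneg_imp_increasing_open[of x y ?D] that continuous_on_subset[OF contD]
      by (metis atLeastatMost_subset_iff)
  qed simp
  show "G b - G a \<le> arccos (u b) - arccos (u a)"
    using mono[of a b] \<open>a < b\<close> by simp
  show "G b - G a = arccos (u b) - arccos (u a) \<longleftrightarrow> (\<forall>t\<in>{a..b}. d t = 0)" (is "?L \<longleftrightarrow> ?R")
  proof
    assume ?L
    have const: "?D t = ?D a" if "t \<in> {a..b}" for t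
      using mono[of a t] mono[of t b] that \<open>?L\<close> by simp
    have z: "d t = 0" if t: "t \<in> {a<..<b}" for t
    proof -
      have "\<forall>\<^sub>F x in nhds t. ?D x = ?D a"
        using eventually_nhds_in_open[of "{a<..<b}" t] t by (auto elim!: eventually_mono intro: const)
      then have "(?D has_real_derivative 0) (at t)"
        by (subst DERIV_cong_ev[OF refl _ refl, where g = "\<lambda>_. ?D a"]) auto
      then have "?D' t = 0"
        using D[OF t] DERIV_unique by blast
      then show ?thesis using iff0[OF t] by blast
    qed
    \<comment> \<open>The zero set of \<open>d\<close> is closed and therefore contains the end
      points too.\<close>
    have "{a<..<b} \<subseteq> {t \<in> {a..b}. d t = 0}" using z by auto
    moreover have "closed {t \<in> {a..b}. d t = 0}"
      using cont(3) by (intro continuous_closed_preimage_constant) auto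
    ultimately have "closure {a<..<b} \<subseteq> {t \<in> {a..b}. d t = 0}" by (rule closure_minimal)
    then show ?R using \<open>a < b\<close> by auto
  next
    assume ?R
    have "?D b = ?D a"
      by (rule DERIV_isconst_end[OF \<open>a < b\<close> contD]) (use D iff0 \<open>?R\<close> in force)
    then show ?L by simp
  qed
qed

text \<open>While \<open>\<bar>u\<bar> < 1\<close> the identity keeps \<open>u'\<close> away from 0,
  so \<open>u'\<close> has constant sign by connectedness. The increasing case is reduced to the
  decreasing one by passing to \<open>- u\<close>.\<close>

lemma length_le_arccos_diff:
  fixes u u' v d G :: "real \<Rightarrow> real"
  assumes "a < b"
    and u: "\<And>t. (u has_real_derivative u' t) (at t)"
    and G: "\<And>t. (G has_real_derivative v t) (at t)"
    and v: "\<And>t. v t > 0"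
    and cont: "continuous_on {a..b} u'" "continuous_on {a..b} v" "continuous_on {a..b} d"
    and eq: "\<And>t. (u' t)\<^sup>2 = (v t)\<^sup>2 * (1 - (u t)\<^sup>2) + (d t)\<^sup>2"
    and bound: "\<And>t. t \<in> {a<..<b} \<Longrightarrow> \<bar>u t\<bar> < 1"
    and ends: "\<bar>u a\<bar> \<le> 1" "\<bar>u b\<bar> \<le> 1"
  shows "G b - G a \<le> \<bar>arccos (u b) - arccos (u a)\<bar>" (is "?le")
    and "G b - G a = \<bar>arccos (u b) - arccos (u a)\<bar> \<longleftrightarrow> (\<forall>t\<in>{a..b}. d t = 0)" (is "?iff")
proof -
  have nz: "u' t \<noteq> 0" if "t \<in> {a<..<b}" for t
  proof -
    have "(v t)\<^sup>2 * (1 - (u t)\<^sup>2) > 0"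
      using v[of t] bound[OF that] by (simp add: abs_square_less_1)
    then have "(u' t)\<^sup>2 > 0" unfolding eq by (simp add: add_pos_nonneg)
    then show ?thesis by auto
  qed
  have "connected (u' ` {a<..<b})"
    by (intro connected_continuous_image continuous_on_subset[OF cont(1)]) auto
  have sgn: "(\<forall>t\<in>{a<..<b}. u' t < 0) \<or> (\<forall>t\<in>{a<..<b}. - u' t < 0)"
  proof (rule ccontr)
    assume "\<not> ?thesis"
    then obtain x y where "x \<in> {a<..<b}" "y \<in> {a<..<b}" "u' x \<ge> 0" "u' y \<le> 0"
      by (auto simp: not_less)
    then have "0 \<in> u' ` {a<..<b}"
      using \<open>connected (u' ` {a<..<b})\<close> unfolding connected_iff_interval by blast
    then show False using nz by force
  qed
  have G_le: "G a < G b"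
    using \<open>a < b\<close> by (rule DERIV_pos_imp_increasing) (use G v in blast)
  from sgn show ?le ?iff
  proof (atomize (full), elim disjE)
    assume "\<forall>t\<in>{a<..<b}. u' t < 0"
    then show "?le \<and> ?iff"
      using length_le_arccos_diff_neg[OF \<open>a < b\<close> u G v cont eq bound ends] G_le by auto
  next
    assume n: "\<forall>t\<in>{a<..<b}. - u' t < 0"
    have u2: "((\<lambda>t. - u t) has_real_derivative - u' t) (at t)" for t
      using DERIV_minus[OF u] by simp
    have "continuous_on {a..b} (\<lambda>t. - u' t)" by (intro continuous_intros cont)
    from length_le_arccos_diff_neg[OF \<open>a < b\<close> u2 G v this cont(2,3)] n eq bound G_le ends
    show "?le \<and> ?iff" by (auto simp: arccos_minus)
  qed
qed

text \<open>The equations arise by pairing a balanced relation of three unit vectors with each of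
  them; \<open>x\<close>, \<open>y\<close>, \<open>z\<close> are their products. The Gram matrix is
  then singular, which makes \<open>z\<close> the cosine of
  \<open>arccos x + arccos y\<close>.\<close>

lemma arccos_sum_le_if_gram_singular:
  fixes x y z a b c :: real
  assumes pos: "a > 0" "b > 0" "c > 0"
    and bounds: "\<bar>x\<bar> < 1" "\<bar>y\<bar> < 1" "\<bar>z\<bar> < 1"
    and eqs: "a + b * x + c * z = 0" "a * x + b + c * y = 0" "a * z + b * y + c = 0"
  shows "arccos x + arccos y + arccos z \<le> 2 * pi"
proof -
  have sq: "1 - x\<^sup>2 > 0" "1 - y\<^sup>2 > 0"
    using bounds by (simp_all add: abs_square_less_1)
  \<comment> \<open>This determines the sign of \<open>x * y - z\<close>, and with it the branch of
    the square root taken below.\<close>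
  have "a * (x * y - z) = c * (1 - y\<^sup>2)"
    using eqs by (simp add: power2_eq_square) algebra
  moreover have "c * (1 - y\<^sup>2) > 0" using pos sq by simp
  ultimately have ge: "x * y - z > 0"
    using pos by (metis zero_less_mult_pos)
  have "c * (1 + 2 * x * y * z - x\<^sup>2 - y\<^sup>2 - z\<^sup>2) = 0"
    using eqs by algebra
  then have "1 + 2 * x * y * z - x\<^sup>2 - y\<^sup>2 - z\<^sup>2 = 0"
    using pos by simp
  then have "(x * y - z)\<^sup>2 = (1 - x\<^sup>2) * (1 - y\<^sup>2)"
    by (simp add: power2_eq_square algebra_simps)
  then have "x * y - z = sqrt (1 - x\<^sup>2) * sqrt (1 - y\<^sup>2)"
    using ge by (simp add: real_sqrt_unique flip: real_sqrt_mult)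
  then have z: "z = cos (arccos x + arccos y)"
    using bounds by (simp add: cos_add sin_arccos_abs)
  show ?thesis
  proof (cases "arccos x + arccos y \<le> pi")
    case True
    then have "arccos z = arccos x + arccos y"
      unfolding z using bounds by (intro arccos_cos) (auto intro!: add_nonneg_nonneg arccos_lbound)
    then show ?thesis using True by simp
  next
    case False
    have "arccos x \<le> pi" "arccos y \<le> pi" using bounds by (auto intro!: arccos_ubound)
    moreover have "z = cos (2 * pi - (arccos x + arccos y))"
      unfolding z by (simp add: cos_diff)
    ultimately have "arccos z = 2 * pi - (arccos x + arccos y)"
      using False arccos_cos[of "2 * pi - (arccos x + arccos y)"] by simp
    then show ?thesis by simp
  qed
qed

text \<open>A closed spacelike curve of winding number 1 on the de Sitter sphere, detached from the
  space curve. Time runs over all reals, so that arcs may cross the end of a period.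
  \<open>G\<close> is an arc length, \<open>sqrt (1 + (T t $ 3)\<^sup>2)\<close> is the cosh of the
  latitude, and \<open>latitude\<close> is the integrated form of spacelikeness.\<close>

locale de_sitter_loop =
  fixes T T' :: "real \<Rightarrow> real^3" and G \<Theta> :: "real \<Rightarrow> real" and P :: real
  assumes deriv: "(T has_vector_derivative T' t) (at t)"
    and cont': "continuous_on UNIV T'"
    and unit: "lorentz (T t) (T t) = 1"
    and spacelike': "lorentz (T' t) (T' t) > 0"
    and arclength: "(G has_real_derivative sqrt (lorentz (T' t) (T' t))) (at t)"
    and P_pos: "P > 0"
    and period: "T (t + P) = T t"
    and longitude: "T t $ 1 = sqrt (1 + (T t $ 3)\<^sup>2) * cos (\<Theta> t)"
      "T t $ 2 = sqrt (1 + (T t $ 3)\<^sup>2) * sin (\<Theta> t)"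
    and cont_longitude: "continuous_on UNIV \<Theta>"
    and winding: "\<Theta> (t + P) = \<Theta> t + 2 * pi"
    and latitude: "s < t \<Longrightarrow> \<bar>arctan (T t $ 3) - arctan (T s $ 3)\<bar> < \<Theta> t - \<Theta> s"
begin

text \<open>The conformal latitude: in the coordinates \<open>(\<theta>, \<psi>)\<close> the metric of the de Sitter sphere is
  \<open>(d\<theta>\<^sup>2 - d\<psi>\<^sup>2) / cos\<^sup>2 \<psi>\<close>.\<close>

definition \<psi> :: "real \<Rightarrow> real" where "\<psi> t = arctan (T t $ 3)"

lemma \<psi>_diff: "s < t \<Longrightarrow> \<bar>\<psi> t - \<psi> s\<bar> < \<Theta> t - \<Theta> s"
  unfolding \<psi>_def by (rule latitude)

section \<open>Causal relations between points of the loop\<close>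

lemma longitude_mono: "s < t \<Longrightarrow> \<Theta> s < \<Theta> t"
  using \<psi>_diff[of s t] by linarith

lemma \<psi>_period: "\<psi> (t + P) = \<psi> t"
  by (simp add: \<psi>_def period)

lemma cos_\<psi>_pos: "cos (\<psi> t) > 0"
  unfolding \<psi>_def by (simp add: cos_arctan add_pos_nonneg)

lemma abs_\<psi>_less: "\<bar>\<psi> t\<bar> < pi / 2"
  using arctan_ubound[of "T t $ 3"] arctan_lbound[of "T t $ 3"] unfolding \<psi>_def by linarith

text \<open>The cosine of the conformal latitude is the inverse of the cosh of the latitude.
  Clearing it from the denominators turns \<open>T t\<close> into a vector of sines and cosines, and
  products of points into differences of cosines.\<close>

lemma coords:
  "T t $ 1 * cos (\<psi> t) = cos (\<Theta> t)" "T t $ 2 * cos (\<psi> t) = sin (\<Theta> t)" "T t $ 3 * cos (\<psi> t) = sin (\<psi> t)"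
proof -
  have "sqrt (1 + (T t $ 3)\<^sup>2) \<noteq> 0"
    by (metis add_pos_nonneg less_irrefl real_sqrt_gt_zero zero_le_power2 zero_less_one)
  then show "T t $ 1 * cos (\<psi> t) = cos (\<Theta> t)" "T t $ 2 * cos (\<psi> t) = sin (\<Theta> t)" "T t $ 3 * cos (\<psi> t) = sin (\<psi> t)"
    using longitude[of t] by (simp_all add: \<psi>_def cos_arctan sin_arctan)
qed

lemma lorentz_T:
  "lorentz (T s) (T t) * (cos (\<psi> s) * cos (\<psi> t)) = cos (\<Theta> t - \<Theta> s) - sin (\<psi> s) * sin (\<psi> t)"
  unfolding coords[symmetric] cos_diff by (simp add: lorentz_def algebra_simps)

text \<open>After multiplication by the positive cosines, the claim compares the cosine of the
  longitude difference with that of the latitude difference. The latter angle is smaller than the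
  longitude difference in both directions around the loop; the second direction leads from
  \<open>t\<close> to \<open>s + P\<close>.\<close>

lemma lorentz_less_1:
  assumes "s < t" "t < s + P"
  shows "lorentz (T s) (T t) < 1"
proof -
  have 1: "\<bar>\<psi> t - \<psi> s\<bar> < \<Theta> t - \<Theta> s" using \<psi>_diff assms(1) .
  have 2: "\<bar>\<psi> t - \<psi> s\<bar> < 2 * pi - (\<Theta> t - \<Theta> s)"
    using \<psi>_diff[OF assms(2)] by (simp add: \<psi>_period winding)
  have "cos (\<Theta> t - \<Theta> s) < cos \<bar>\<psi> t - \<psi> s\<bar>"
  proof (cases "\<Theta> t - \<Theta> s \<le> pi")
    case True
    then show ?thesis using 1 by (intro cos_monotone_0_pi) auto
  next
    case False
    then have "cos (2 * pi - (\<Theta> t - \<Theta> s)) < cos \<bar>\<psi> t - \<psi> s\<bar>"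
      using 2 by (intro cos_monotone_0_pi) auto
    then show ?thesis by (simp add: cos_diff[of "2 * pi"])
  qed
  then have "lorentz (T s) (T t) * (cos (\<psi> s) * cos (\<psi> t)) < 1 * (cos (\<psi> s) * cos (\<psi> t))"
    unfolding lorentz_T by (simp add: cos_diff algebra_simps)
  then show ?thesis
    using cos_\<psi>_pos[of s] cos_\<psi>_pos[of t] by (simp add: zero_less_mult_iff)
qed

text \<open>Here \<open>T t\<close> is compared with the antipode of \<open>T s\<close>, which has
  longitude \<open>\<Theta> s + pi\<close> and conformal latitude \<open>- \<psi> s\<close>.
  Clearing the cosines leaves a comparison of cosines of two angles in
  \<open>[0, pi]\<close>.\<close>

lemma lorentz_ge_minus_1_iff:
  assumes "s < t" "\<Theta> t - \<Theta> s \<le> pi"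
  shows "- 1 \<le> lorentz (T s) (T t) \<longleftrightarrow> \<bar>\<psi> s + \<psi> t\<bar> \<le> pi - (\<Theta> t - \<Theta> s)"
    and "- 1 < lorentz (T s) (T t) \<longleftrightarrow> \<bar>\<psi> s + \<psi> t\<bar> < pi - (\<Theta> t - \<Theta> s)"
proof -
  have pos: "cos (\<psi> s) * cos (\<psi> t) > 0" using cos_\<psi>_pos by simp
  have eq: "lorentz (T s) (T t) * (cos (\<psi> s) * cos (\<psi> t)) - - 1 * (cos (\<psi> s) * cos (\<psi> t))
      = cos \<bar>\<psi> s + \<psi> t\<bar> - cos (pi - (\<Theta> t - \<Theta> s))"
    unfolding lorentz_T by (simp add: cos_add)
  have b: "0 \<le> \<bar>\<psi> s + \<psi> t\<bar>" "\<bar>\<psi> s + \<psi> t\<bar> \<le> pi" "0 \<le> pi - (\<Theta> t - \<Theta> s)" "pi - (\<Theta> t - \<Theta> s) \<le> pi"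
    using abs_\<psi>_less[of s] abs_\<psi>_less[of t] longitude_mono[OF assms(1)] assms(2) by linarith+
  have "- 1 \<le> lorentz (T s) (T t) \<longleftrightarrow> cos (pi - (\<Theta> t - \<Theta> s)) \<le> cos \<bar>\<psi> s + \<psi> t\<bar>"
    using eq pos mult_le_cancel_right_pos[OF pos, of "-1" "lorentz (T s) (T t)"] by linarith
  then show "- 1 \<le> lorentz (T s) (T t) \<longleftrightarrow> \<bar>\<psi> s + \<psi> t\<bar> \<le> pi - (\<Theta> t - \<Theta> s)"
    using cos_mono_le_eq[OF b(3,4,1,2)] by simp
  have "- 1 < lorentz (T s) (T t) \<longleftrightarrow> cos (pi - (\<Theta> t - \<Theta> s)) < cos \<bar>\<psi> s + \<psi> t\<bar>"
    using eq pos mult_less_cancel_right_pos[OF pos, of "-1" "lorentz (T s) (T t)"] by linarith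
  then show "- 1 < lorentz (T s) (T t) \<longleftrightarrow> \<bar>\<psi> s + \<psi> t\<bar> < pi - (\<Theta> t - \<Theta> s)"
    using cos_mono_less_eq[OF b(3,4,1,2)] by simp
qed

text \<open>The lower bound on the product is what the arccos of the product requires; the upper
  bound is \<open>lorentz_less_1\<close>. The restriction to half a turn makes the property pass to
  subarcs.\<close>

definition arc :: "real \<Rightarrow> real \<Rightarrow> bool" where
  "arc s t \<longleftrightarrow> s < t \<and> \<Theta> t - \<Theta> s \<le> pi \<and> - 1 \<le> lorentz (T s) (T t)"

lemma arc_less_period:
  assumes "arc s t"
  shows "t < s + P"
proof (rule ccontr)
  assume "\<not> ?thesis"
  then have "\<Theta> (s + P) \<le> \<Theta> t"
    using longitude_mono[of "s + P" t] by (cases "t = s + P") auto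
  then show False using assms pi_gt_zero unfolding winding arc_def by linarith
qed

text \<open>Shortening an arc changes the conformal latitudes of its ends by at most the longitude
  that is released, and by strictly less at an end that really moves. Hence the bound on
  \<open>\<bar>\<psi> s + \<psi> t\<bar>\<close> persists and becomes strict.\<close>

lemma subarc:
  assumes "arc s t" "s \<le> x" "x < y" "y \<le> t"
  shows "arc x y" and "s < x \<or> y < t \<Longrightarrow> - 1 < lorentz (T x) (T y)"
proof -
  have st: "s < t" "\<Theta> t - \<Theta> s \<le> pi" "\<bar>\<psi> s + \<psi> t\<bar> \<le> pi - (\<Theta> t - \<Theta> s)"
    using assms(1) lorentz_ge_minus_1_iff unfolding arc_def by auto
  have x: "\<bar>\<psi> x - \<psi> s\<bar> \<le> \<Theta> x - \<Theta> s" "s < x \<Longrightarrow> \<bar>\<psi> x - \<psi> s\<bar> < \<Theta> x - \<Theta> s"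
    using \<psi>_diff[of s x] assms(2) by (cases "s = x"; force)+
  have y: "\<bar>\<psi> t - \<psi> y\<bar> \<le> \<Theta> t - \<Theta> y" "y < t \<Longrightarrow> \<bar>\<psi> t - \<psi> y\<bar> < \<Theta> t - \<Theta> y"
    using \<psi>_diff[of y t] assms(4) by (cases "y = t"; force)+
  have *: "\<Theta> y - \<Theta> x \<le> pi" using st x y by linarith
  have "\<bar>\<psi> x + \<psi> y\<bar> \<le> pi - (\<Theta> y - \<Theta> x)" using st x(1) y(1) by linarith
  then show "arc x y"
    using lorentz_ge_minus_1_iff(1)[OF assms(3) *] * assms(3) unfolding arc_def by blast
  assume "s < x \<or> y < t"
  then have "\<bar>\<psi> x + \<psi> y\<bar> < pi - (\<Theta> y - \<Theta> x)" using st x y by linarith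
  then show "- 1 < lorentz (T x) (T y)"
    using lorentz_ge_minus_1_iff(2)[OF assms(3) *] by blast
qed

section \<open>Arc length and the Lorentz product of the end points\<close>

lemma orthogonal: "lorentz (T t) (T' t) = 0"
  by (rule lorentz_orthogonal_derivative[OF deriv unit])

lemma T'_period: "T' (t + P) = T' t"
  using has_vector_derivative_periodic[of T, OF deriv period] .

lemma cross3_nonzero: "cross3 (T t) (T' t) \<noteq> 0"
  by (rule cross3_nonzero_if_gram) (use spacelike'[of t] in \<open>simp add: orthogonal unit\<close>)

text \<open>At the end where \<open>T\<close> equals \<open>p\<close> the product with
  \<open>p\<close> is 1 and its arccos is 0, so the arccos difference is that of the product of the
  ends; inside, \<open>subarc\<close> keeps the product strictly between -1 and 1. Either end may
  serve as \<open>p\<close>: the length bound is the same, but the determinants that vanish in the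
  case of equality differ, and both kinds are needed.\<close>

lemma arc_length_aux:
  assumes "arc s t" "p = T s \<or> p = T t"
  shows "G t - G s \<le> arccos (lorentz (T s) (T t))"
    and "G t - G s = arccos (lorentz (T s) (T t)) \<longleftrightarrow> (\<forall>x\<in>{s..t}. p \<bullet> cross3 (T x) (T' x) = 0)"
proof -
  have "s < t" using assms(1) by (simp add: arc_def)
  let ?u = "\<lambda>x. lorentz p (T x)"
  have c: "lorentz (T s) (T t) < 1" "- 1 \<le> lorentz (T s) (T t)"
    using assms(1) arc_less_period lorentz_less_1 by (auto simp: arc_def)
  have unit_p: "lorentz p p = 1" using assms(2) unit by auto
  have u: "(?u has_real_derivative lorentz p (T' x)) (at x)" for x
    by (intro lorentz_const_has_real_derivative deriv)
  have contT: "continuous_on S T" for S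
    by (meson continuous_at_imp_continuous_on deriv has_vector_derivative_continuous)
  have contT': "continuous_on S T'" for S
    using cont' continuous_on_subset by blast
  have cont: "continuous_on {s..t} (\<lambda>x. lorentz p (T' x))"
    "continuous_on {s..t} (\<lambda>x. sqrt (lorentz (T' x) (T' x)))"
    "continuous_on {s..t} (\<lambda>x. p \<bullet> cross3 (T x) (T' x))"
    by (intro continuous_intros continuous_on_cross contT contT')+
  have eq: "(lorentz p (T' x))\<^sup>2 = (sqrt (lorentz (T' x) (T' x)))\<^sup>2 * (1 - (?u x)\<^sup>2) + (p \<bullet> cross3 (T x) (T' x))\<^sup>2" for x
    using spacelike'[of x] unfolding lorentz_gram by (simp add: orthogonal unit unit_p algebra_simps)
  have bound: "\<bar>?u x\<bar> < 1" if "x \<in> {s<..<t}" for x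
  proof -
    have "t < s + P" using arc_less_period assms(1) .
    then have "\<bar>lorentz (T s) (T x)\<bar> < 1" "\<bar>lorentz (T x) (T t)\<bar> < 1"
      using subarc(2)[OF assms(1), of s x] subarc(2)[OF assms(1), of x t] that
        lorentz_less_1[of s x] lorentz_less_1[of x t] by (auto simp: abs_less_iff)
    then show ?thesis using assms(2) by (auto simp: lorentz_commute)
  qed
  have ends: "\<bar>?u s\<bar> \<le> 1" "\<bar>?u t\<bar> \<le> 1"
    using c assms(2) by (auto simp: unit lorentz_commute abs_le_iff)
  have "\<bar>arccos (?u t) - arccos (?u s)\<bar> = arccos (lorentz (T s) (T t))"
    using c assms(2) arccos_lbound[of "lorentz (T s) (T t)"] by (auto simp: unit lorentz_commute)
  then show "G t - G s \<le> arccos (lorentz (T s) (T t))"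
    "G t - G s = arccos (lorentz (T s) (T t)) \<longleftrightarrow> (\<forall>x\<in>{s..t}. p \<bullet> cross3 (T x) (T' x) = 0)"
    using length_le_arccos_diff[OF \<open>s < t\<close> u arclength _ cont eq bound ends] spacelike' by simp_all
qed

lemma arc_length_le: "arc s t \<Longrightarrow> G t - G s \<le> arccos (lorentz (T s) (T t))"
  by (rule arc_length_aux) auto

lemmas arc_length_eq_iff_left = arc_length_aux(2)[OF _ disjI1[OF refl]]

lemmas arc_length_eq_iff_right = arc_length_aux(2)[OF _ disjI2[OF refl]]

lemma arclength_period: "G (t + P) - G t = G P - G 0"
proof -
  have "((\<lambda>t. G (t + P) - G t) has_real_derivative 0) (at t)" for t
  proof -
    have "((\<lambda>t. G (t + P)) has_real_derivative sqrt (lorentz (T' t) (T' t))) (at t)"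
      using arclength[of "t + P"] by (simp add: T'_period DERIV_shift)
    from DERIV_diff[OF this arclength[of t]] show ?thesis by simp
  qed
  then show ?thesis
    using DERIV_isconst_all[of "\<lambda>t. G (t + P) - G t" t 0] by simp
qed

subsection \<open>The length of a loop\<close>

text \<open>The common goal of the case distinction on balanced points. The plane in the equality
  clause is spanned by \<open>T t\<^sub>0\<close> and \<open>T' t\<^sub>0\<close>, since for the
  tangent indicatrix this is an osculating plane and hence known to be spacelike.\<close>

definition fenchel :: bool where
  "fenchel \<longleftrightarrow> G P - G 0 \<le> 2 * pi \<and>
     (G P - G 0 = 2 * pi \<longrightarrow> (\<exists>t\<^sub>0. \<forall>t. T t \<bullet> cross3 (T t\<^sub>0) (T' t\<^sub>0) = 0))"

lemma planar_if_on_period: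
  assumes "\<And>t. t \<in> {s..<s + P} \<Longrightarrow> T t \<bullet> n = 0"
  shows "T t \<bullet> n = 0"
proof -
  obtain u where "u \<in> {s..<s + P}" "T t = T u"
    using periodic_reduce[OF P_pos, of T s t] period by blast
  then show ?thesis using assms by simp
qed

text \<open>Antipodal points have opposite conformal latitudes and product -1, which forces the
  cosine of the longitude difference to be -1; that difference lies strictly between 0 and
  \<open>2 * pi\<close>.\<close>

lemma antipodal_half_turn:
  assumes "s < t" "t < s + P" "T t = - T s"
  shows "\<Theta> t - \<Theta> s = pi"
proof -
  have \<psi>: "\<psi> t = - \<psi> s" using assms by (simp add: \<psi>_def arctan_minus)
  have "lorentz (T s) (T t) = - 1" using assms by (simp add: lorentz_minus_right unit)
  then have "cos (\<Theta> t - \<Theta> s) = - (cos (\<psi> s))\<^sup>2 - (sin (\<psi> s))\<^sup>2"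
    using lorentz_T[of s t] by (simp add: \<psi> power2_eq_square)
  then have cos: "cos (\<Theta> t - \<Theta> s) = - 1"
    using sin_cos_squared_add[of "\<psi> s"] by linarith
  have "0 < \<Theta> t - \<Theta> s" "\<Theta> t - \<Theta> s < 2 * pi"
    using longitude_mono[OF assms(1)] longitude_mono[OF assms(2)] by (simp_all add: winding)
  then show ?thesis
    using cos cos_monotone_0_pi[of "\<Theta> t - \<Theta> s" pi] cos_monotone_0_pi[of "2 * pi - (\<Theta> t - \<Theta> s)" pi]
    by (cases "\<Theta> t - \<Theta> s" pi rule: linorder_cases) (auto simp: cos_diff[of "2 * pi"])
qed

lemma half_turn_antipodal:
  assumes "\<Theta> t - \<Theta> s = pi" "\<psi> t = - \<psi> s"
  shows "T t = - T s"
proof -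
  have "\<Theta> t = \<Theta> s + pi" using assms by simp
  then have "T t $ i * cos (\<psi> s) = - T s $ i * cos (\<psi> s)" for i
    using coords[of t] coords[of s] assms(2) exhaust_3[of i] by auto
  then have "T t $ i = (- T s) $ i" for i
    using cos_\<psi>_pos[of s] by (metis less_irrefl mult_right_cancel vector_uminus_component)
  then show ?thesis by (simp add: vec_eq_iff)
qed

lemma antipodal_arc:
  assumes "s < t" "t < s + P" "T t = - T s"
  shows "arc s t"
  using assms antipodal_half_turn[OF assms] by (simp add: arc_def lorentz_minus_right unit)

text \<open>The products of \<open>T x\<close> with the two ends are opposite, so the two arccos
  bounds add up to exactly \<open>pi\<close>. An arc of length \<open>pi\<close> must therefore
  attain both.\<close>

lemma antipodal_length_eq:
  assumes "arc s t" "T t = - T s" "G t - G s = pi" "s < x" "x < t"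
  shows "G x - G s = arccos (lorentz (T s) (T x))" "G t - G x = arccos (lorentz (T x) (T t))"
proof -
  have x: "arc s x" "arc x t"
    using assms by (auto intro!: subarc(1)[OF assms(1)])
  have "x < s + P" using arc_less_period[OF x(1)] .
  then have "lorentz (T s) (T x) < 1" "- 1 \<le> lorentz (T s) (T x)"
    using lorentz_less_1 assms(4) x(1) by (auto simp: arc_def)
  then have "arccos (lorentz (T x) (T t)) = pi - arccos (lorentz (T s) (T x))"
    by (simp add: assms(2) lorentz_minus_right lorentz_commute[of "T x"] arccos_minus)
  then show "G x - G s = arccos (lorentz (T s) (T x))" "G t - G x = arccos (lorentz (T x) (T t))"
    using arc_length_le[OF x(1)] arc_length_le[OF x(2)] assms(3) by linarith+
qed

text \<open>Two antipodal points cut the loop into two arcs, each of length at most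
  \<open>arccos (- 1)\<close>, that is \<open>pi\<close>.\<close>

lemma fenchel_if_antipodal:
  assumes "s < t" "t < s + P" "T t = - T s"
  shows fenchel
proof -
  have arcs: "arc s t" "arc t (s + P)"
    using assms by (auto intro!: antipodal_arc simp: period)
  have le: "G t - G s \<le> pi" "G (s + P) - G t \<le> pi"
    using arc_length_le[OF arcs(1)] arc_length_le[OF arcs(2)]
    by (simp_all add: assms(3) period lorentz_minus_left lorentz_minus_right unit)
  have total: "G P - G 0 = (G t - G s) + (G (s + P) - G t)"
    using arclength_period[of s] by simp
  have "\<forall>x. T x \<bullet> cross3 (T s) (T' s) = 0" if "G P - G 0 = 2 * pi"
  proof (rule allI, rule planar_if_on_period[where s = s])
    fix x assume "x \<in> {s..<s + P}"
    then have "x = s \<or> x = t \<or> s < x \<and> x < t \<or> t < x \<and> x < s + P" by auto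
    then consider "x = s" | "x = t" | "s < x" "x < t" | "t < x" "x < s + P" by blast
    then show "T x \<bullet> cross3 (T s) (T' s) = 0"
    proof cases
      case 3
      have "G t - G s = pi" using that le total by linarith
      then have "G x - G s = arccos (lorentz (T s) (T x))"
        by (rule antipodal_length_eq(1)[OF arcs(1) assms(3) _ 3])
      moreover have "arc s x"
        by (rule subarc(1)[OF arcs(1)]) (use 3 in auto)
      \<comment> \<open>With \<open>T x\<close> as the reference point, the determinant vanishes in
        particular at the parameter \<open>s\<close>.\<close>
      ultimately show ?thesis using arc_length_eq_iff_right[of s x] 3 by simp
    next
      case 4
      have "G (s + P) - G t = pi" using that le total by linarith
      then have "G (s + P) - G x = arccos (lorentz (T x) (T (s + P)))"
        by (rule antipodal_length_eq(2)[OF arcs(2) _ _ 4, rotated]) (simp add: period assms(3))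
      moreover have "arc x (s + P)"
        by (rule subarc(1)[OF arcs(2)]) (use 4 in auto)
      ultimately have "T x \<bullet> cross3 (T (s + P)) (T' (s + P)) = 0"
        using arc_length_eq_iff_left[of x "s + P"] 4 by simp
      then show ?thesis by (simp add: period T'_period)
    qed (simp_all add: assms(3) dot_cross_self)
  qed
  then show ?thesis
    using le total unfolding fenchel_def by auto
qed

text \<open>If the gap exceeded \<open>pi\<close>, the horizontal projections of \<open>T s\<close>
  and \<open>T t\<close> would lie strictly on the same side of the line through the projection of
  \<open>T r\<close>, and a combination with positive \<open>b\<close> and \<open>c\<close> could
  not vanish.\<close>

lemma longitude_gap_le_pi:
  assumes "r < s" "s < t" "t < r + P" and pos: "b > 0" "c > 0"
    and zero: "a *\<^sub>R T r + b *\<^sub>R T s + c *\<^sub>R T t = 0"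
  shows "\<Theta> s - \<Theta> r \<le> pi"
proof (rule ccontr)
  assume "\<not> ?thesis"
  then have "pi < \<Theta> s - \<Theta> r" by simp
  moreover have "\<Theta> s < \<Theta> t" "\<Theta> t < \<Theta> r + 2 * pi"
    using longitude_mono[OF assms(2)] longitude_mono[OF assms(3)] by (simp_all add: winding)
  ultimately have sin: "sin (\<Theta> s - \<Theta> r) < 0" "sin (\<Theta> t - \<Theta> r) < 0"
    by (auto intro!: sin_lt_zero)
  define \<rho> where "\<rho> x = sqrt (1 + (T x $ 3)\<^sup>2)" for x
  have \<rho>: "\<rho> x > 0" for x by (simp add: \<rho>_def add_pos_nonneg)
  have T: "T x $ 1 = \<rho> x * cos (\<Theta> x)" "T x $ 2 = \<rho> x * sin (\<Theta> x)" for x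
    using longitude by (simp_all add: \<rho>_def)
  have 1: "a * T r $ 1 + b * T s $ 1 + c * T t $ 1 = 0"
    and 2: "a * T r $ 2 + b * T s $ 2 + c * T t $ 2 = 0"
    using arg_cong[OF zero, of "\<lambda>x. x $ 1"] arg_cong[OF zero, of "\<lambda>x. x $ 2"] by simp_all
  have "b * \<rho> s * sin (\<Theta> s - \<Theta> r) + c * \<rho> t * sin (\<Theta> t - \<Theta> r)
      = cos (\<Theta> r) * (a * T r $ 2 + b * T s $ 2 + c * T t $ 2)
        - sin (\<Theta> r) * (a * T r $ 1 + b * T s $ 1 + c * T t $ 1)"
    unfolding T sin_diff by (simp add: algebra_simps)
  also have "\<dots> = 0" using 1 2 by simp
  finally have "b * \<rho> s * sin (\<Theta> s - \<Theta> r) + c * \<rho> t * sin (\<Theta> t - \<Theta> r) = 0" .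
  moreover have "b * \<rho> s * sin (\<Theta> s - \<Theta> r) < 0" "c * \<rho> t * sin (\<Theta> t - \<Theta> r) < 0"
    using pos \<rho> sin by (auto simp: mult_less_0_iff)
  ultimately show False by linarith
qed

text \<open>Three balanced points cut the loop into three arcs. Their arccos bounds add up to at
  most \<open>2 * pi\<close>, because the Gram matrix of the points is singular.\<close>

lemma fenchel_if_triple:
  assumes "r < s" "s < t" "t < r + P" and pos: "a > 0" "b > 0" "c > 0"
    and zero: "a *\<^sub>R T r + b *\<^sub>R T s + c *\<^sub>R T t = 0"
  shows fenchel
proof -
  define x y z where "x = lorentz (T r) (T s)" "y = lorentz (T s) (T t)" "z = lorentz (T t) (T r)"
  have eqs: "a + b * x + c * z = 0" "a * x + b + c * y = 0" "a * z + b * y + c = 0"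
  proof -
    have *: "a * lorentz p (T r) + b * lorentz p (T s) + c * lorentz p (T t) = 0" for p
      using arg_cong[OF zero, of "lorentz p"]
      by (simp add: lorentz_add_right lorentz_scaleR_right lorentz_0_right)
    have sym: "lorentz (T s) (T r) = x" "lorentz (T t) (T s) = y" "lorentz (T r) (T t) = z"
      by (auto simp: x_y_z_def lorentz_commute)
    show "a + b * x + c * z = 0" "a * x + b + c * y = 0" "a * z + b * y + c = 0"
      using *[of "T r"] *[of "T s"] *[of "T t"] unfolding sym unit x_y_z_def[symmetric] by simp_all
  qed
  have "x < 1" "y < 1"
    using assms by (auto simp: x_y_z_def intro!: lorentz_less_1)
  moreover have "z < 1"
    using lorentz_less_1[of r t] assms by (simp add: x_y_z_def lorentz_commute)
  ultimately have less: "x < 1" "y < 1" "z < 1" by simp_all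
  \<comment> \<open>Each term of the balanced relation is isolated and multiplied by itself; the
    points are unit vectors.\<close>
  have sq: "c\<^sup>2 = a\<^sup>2 + b\<^sup>2 + 2 * a * b * x" "a\<^sup>2 = b\<^sup>2 + c\<^sup>2 + 2 * b * c * y" "b\<^sup>2 = c\<^sup>2 + a\<^sup>2 + 2 * c * a * z"
    using eqs by algebra+
  \<comment> \<open>Products below 1 give strict triangle inequalities for the coefficients, and
    these in turn keep the products above -1.\<close>
  have lt: "k < l + m" if "k\<^sup>2 = l\<^sup>2 + m\<^sup>2 + 2 * l * m * w" "w < 1" "l > 0" "m > 0" for k l m w :: real
  proof (rule power2_less_imp_less)
    have "2 * l * m * w < 2 * l * m * 1"
      using that by (intro mult_strict_left_mono) auto
    then show "k\<^sup>2 < (l + m)\<^sup>2" unfolding that(1) power2_sum by simp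
  qed (use that in auto)
  have tri: "a < b + c" "b < c + a" "c < a + b"
    using lt[OF sq(2)] lt[OF sq(3)] lt[OF sq(1)] less pos by auto
  have gt: "- 1 < w" if "k\<^sup>2 = l\<^sup>2 + m\<^sup>2 + 2 * l * m * w" "l < m + k" "m < k + l" "l > 0" "m > 0" "k > 0"
    for k l m w :: real
  proof -
    have "\<bar>l - m\<bar> < \<bar>k\<bar>" using that by auto
    then have "(l - m)\<^sup>2 < k\<^sup>2" by (metis abs_le_square_iff linorder_not_less)
    then have "0 < l * m * (1 + w)" using that(1) by (simp add: power2_diff algebra_simps)
    then have "0 < 1 + w" using that by (metis mult_pos_pos zero_less_mult_pos)
    then show ?thesis by simp
  qed
  have bounds: "\<bar>x\<bar> < 1" "\<bar>y\<bar> < 1" "\<bar>z\<bar> < 1"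
    using gt[OF sq(1)] gt[OF sq(2)] gt[OF sq(3)] less tri pos by (auto simp: abs_less_iff)
  \<comment> \<open>Rotating the relation, with passed points moved on by one period, lets the gap
    bound apply to each of the three gaps.\<close>
  have zeros: "b *\<^sub>R T s + c *\<^sub>R T t + a *\<^sub>R T (r + P) = 0"
    "c *\<^sub>R T t + a *\<^sub>R T (r + P) + b *\<^sub>R T (s + P) = 0"
    using zero unfolding period by (simp_all only: ac_simps)
  have lor: "lorentz (T t) (T (r + P)) = z" by (simp add: period x_y_z_def)
  have arcs: "arc r s" "arc s t" "arc t (r + P)"
    using longitude_gap_le_pi[OF assms(1-3) pos(2,3) zero]
      longitude_gap_le_pi[OF assms(2,3) _ pos(3,1) zeros(1)]
      longitude_gap_le_pi[OF assms(3) _ _ pos(1,2) zeros(2)] assms bounds lor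
    by (auto simp: arc_def x_y_z_def abs_less_iff)
  have le: "G s - G r \<le> arccos x" "G t - G s \<le> arccos y" "G (r + P) - G t \<le> arccos z"
    using arcs[THEN arc_length_le] lor by (simp_all add: x_y_z_def)
  have sum: "arccos x + arccos y + arccos z \<le> 2 * pi"
    using arccos_sum_le_if_gram_singular[OF pos bounds eqs] .
  have total: "G P - G 0 = (G s - G r) + (G t - G s) + (G (r + P) - G t)"
    using arclength_period[of r] by simp
  have "\<forall>w. T w \<bullet> cross3 (T r) (T' r) = 0" if full: "G P - G 0 = 2 * pi"
  proof (rule allI, rule planar_if_on_period[where s = r])
    let ?n = "cross3 (T r) (T' r)"
    have eq: "G s - G r = arccos x" "G t - G s = arccos y" "G (r + P) - G t = arccos z"
      using full le sum total by linarith+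
    note coplanar = arcs[THEN arc_length_eq_iff_left] arcs[THEN arc_length_eq_iff_right]
    have nr: "?n \<bullet> T r = 0" by (simp add: dot_cross_self)
    \<comment> \<open>Equality on the first arc, with \<open>T s\<close> as the reference point, is
      evaluated at \<open>r\<close>; the balanced relation then puts \<open>T t\<close> into the
      same plane.\<close>
    have ns: "?n \<bullet> T s = 0"
      using coplanar(4) eq(1) assms(1) by (auto simp: x_y_z_def inner_commute)
    have "?n \<bullet> (a *\<^sub>R T r + b *\<^sub>R T s + c *\<^sub>R T t) = 0" by (simp add: zero)
    then have nt: "?n \<bullet> T t = 0"
      using nr ns pos by (simp add: inner_add_right)
    \<comment> \<open>In the case of equality the plane of \<open>T w\<close> and
      \<open>T' w\<close> contains both ends of the arc through \<open>w\<close>. These ends are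
      independent, so that plane is the one with normal \<open>?n\<close>.\<close>
    have main: "T w \<bullet> ?n = 0"
      if "i \<le> w" "w \<le> j" "?n \<bullet> T i = 0" "?n \<bullet> T j = 0" "\<bar>lorentz (T i) (T j)\<bar> < 1"
        "\<forall>w\<in>{i..j}. T i \<bullet> cross3 (T w) (T' w) = 0" "\<forall>w\<in>{i..j}. T j \<bullet> cross3 (T w) (T' w) = 0" for i j w
    proof -
      have "(lorentz (T i) (T j))\<^sup>2 < 1" using that(5) by (simp add: abs_square_less_1)
      then have "cross3 (T i) (T j) \<noteq> 0"
        by (intro cross3_nonzero_if_gram) (simp add: unit)
      moreover have "cross3 (T w) (T' w) \<bullet> T i = 0" "cross3 (T w) (T' w) \<bullet> T j = 0"
        using that by (auto simp: inner_commute)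
      moreover have "cross3 (T w) (T' w) \<bullet> T w = 0" by (simp add: dot_cross_self)
      ultimately have "?n \<bullet> T w = 0"
        using inner_eq_0_if_coplanar[OF _ cross3_nonzero[of w]] that(3,4) by blast
      then show ?thesis by (simp add: inner_commute)
    qed
    fix w assume "w \<in> {r..<r + P}"
    then have "w \<in> {r..s} \<or> w \<in> {s..t} \<or> w \<in> {t..r + P}" by auto
    then consider "w \<in> {r..s}" | "w \<in> {s..t}" | "w \<in> {t..r + P}" by blast
    then show "T w \<bullet> ?n = 0"
    proof cases
      case 1
      then show ?thesis
        using main[of r w s] nr ns coplanar(1,4) eq bounds by (auto simp: x_y_z_def)
    next
      case 2
      then show ?thesis
        using main[of s w t] nt ns coplanar(2,5) eq bounds by (auto simp: x_y_z_def)
    next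
      case 3
      then show ?thesis
        using main[of t w "r + P"] nt nr coplanar(3,6) eq bounds lor by (auto simp: period)
    qed
  qed
  then show ?thesis
    using le sum total unfolding fenchel_def by auto
qed

text \<open>Unit vectors that balance have equal coefficients and so are antipodal.\<close>

lemma fenchel_if_two:
  assumes "s \<in> {0..<P}" "t \<in> {0..<P}" and nonneg: "a \<ge> 0" "b \<ge> 0" "a + b > 0"
    and zero: "a *\<^sub>R T s + b *\<^sub>R T t = 0"
  shows fenchel
proof -
  have "a *\<^sub>R T s = (- b) *\<^sub>R T t"
    using zero by (simp add: eq_neg_iff_add_eq_0)
  then have "lorentz (a *\<^sub>R T s) (a *\<^sub>R T s) = lorentz ((- b) *\<^sub>R T t) ((- b) *\<^sub>R T t)"
    by simp
  then have "a\<^sup>2 = b\<^sup>2"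
    by (simp add: lorentz_scaleR_left lorentz_scaleR_right unit power2_eq_square lorentz_minus_left lorentz_minus_right)
  then have ab: "a = b" "a > 0"
    using nonneg by (auto simp: power2_eq_iff)
  then have "a *\<^sub>R (T s + T t) = 0"
    using zero by (simp add: scaleR_add_right)
  then have anti: "T t = - T s" "T s = - T t"
    using ab by (simp_all add: add_eq_0_iff)
  have "s \<noteq> t"
  proof
    assume "s = t"
    then have "T s = - T s" using anti by simp
    then have "lorentz (T s) (T s) = - lorentz (T s) (T s)" by (metis lorentz_minus_left)
    then show False by (simp add: unit)
  qed
  then consider "s < t" | "t < s" by linarith
  then show ?thesis
  proof cases
    case 1
    then show ?thesis by (rule fenchel_if_antipodal) (use assms(1,2) anti in auto)
  next
    case 2
    then show ?thesis by (rule fenchel_if_antipodal) (use assms(1,2) anti in auto)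
  qed
qed

text \<open>A vanishing coefficient or a repeated parameter reduces the balanced triple to two
  points. Otherwise the three parameters are put in increasing order within one period.\<close>

lemma fenchel_if_zero_in_hull:
  assumes "0 \<in> convex hull (range T)"
  shows fenchel
proof -
  have "connected (range T)"
    using connected_continuous_image[of UNIV T] deriv
    by (meson connected_UNIV continuous_at_imp_continuous_on has_vector_derivative_continuous)
  then obtain p q r a b c where pqr: "p \<in> range T" "q \<in> range T" "r \<in> range T"
    and nonneg: "a \<ge> 0" "b \<ge> 0" "c \<ge> 0" "a + b + c > 0"
    and zero: "a *\<^sub>R p + b *\<^sub>R q + c *\<^sub>R r = 0"
    using zero_combination_of_three[OF _ assms] by blast
  have time: "\<exists>t\<in>{0..<P}. x = T t" if x: "x \<in> range T" for x
  proof -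
    obtain u where "x = T u" using x by blast
    moreover obtain s where "s \<in> {0..<0 + P}" "T u = T s"
      using periodic_reduce[of P T 0 u, OF P_pos period] .
    ultimately show ?thesis by auto
  qed
  obtain t\<^sub>1 t\<^sub>2 t\<^sub>3 where t: "t\<^sub>1 \<in> {0..<P}" "t\<^sub>2 \<in> {0..<P}" "t\<^sub>3 \<in> {0..<P}"
    and T: "p = T t\<^sub>1" "q = T t\<^sub>2" "r = T t\<^sub>3"
    using time[OF pqr(1)] time[OF pqr(2)] time[OF pqr(3)] by blast
  note zero = zero[unfolded T]
  have zeros: "a *\<^sub>R T t\<^sub>1 + c *\<^sub>R T t\<^sub>3 + b *\<^sub>R T t\<^sub>2 = 0" "b *\<^sub>R T t\<^sub>2 + a *\<^sub>R T t\<^sub>1 + c *\<^sub>R T t\<^sub>3 = 0"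
    "b *\<^sub>R T t\<^sub>2 + c *\<^sub>R T t\<^sub>3 + a *\<^sub>R T t\<^sub>1 = 0" "c *\<^sub>R T t\<^sub>3 + a *\<^sub>R T t\<^sub>1 + b *\<^sub>R T t\<^sub>2 = 0"
    "c *\<^sub>R T t\<^sub>3 + b *\<^sub>R T t\<^sub>2 + a *\<^sub>R T t\<^sub>1 = 0"
    using zero by (simp_all only: ac_simps)
  have "a = 0 \<or> b = 0 \<or> c = 0 \<or> t\<^sub>1 = t\<^sub>2 \<or> t\<^sub>1 = t\<^sub>3 \<or> t\<^sub>2 = t\<^sub>3 \<or>
      a > 0 \<and> b > 0 \<and> c > 0 \<and> t\<^sub>1 \<noteq> t\<^sub>2 \<and> t\<^sub>1 \<noteq> t\<^sub>3 \<and> t\<^sub>2 \<noteq> t\<^sub>3"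
    using nonneg by auto
  then consider "a = 0" | "b = 0" | "c = 0" | "t\<^sub>1 = t\<^sub>2" | "t\<^sub>1 = t\<^sub>3" | "t\<^sub>2 = t\<^sub>3"
    | "a > 0" "b > 0" "c > 0" "t\<^sub>1 \<noteq> t\<^sub>2" "t\<^sub>1 \<noteq> t\<^sub>3" "t\<^sub>2 \<noteq> t\<^sub>3"
    by blast
  then show ?thesis
  proof cases
    case 1
    then show ?thesis using fenchel_if_two[OF t(2,3) nonneg(2,3)] nonneg zero by simp
  next
    case 2
    then show ?thesis using fenchel_if_two[OF t(1,3) nonneg(1,3)] nonneg zero by simp
  next
    case 3
    then show ?thesis using fenchel_if_two[OF t(1,2) nonneg(1,2)] nonneg zero by simp
  next
    case 4
    then show ?thesis
      using fenchel_if_two[OF t(1,3), of "a + b" c] nonneg zero by (simp add: scaleR_add_left)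
  next
    case 5
    then show ?thesis
      using fenchel_if_two[OF t(1,2), of "a + c" b] nonneg zeros(1) by (simp add: scaleR_add_left)
  next
    case 6
    then show ?thesis
      using fenchel_if_two[OF t(2,1), of "b + c" a] nonneg zeros(3) by (simp add: scaleR_add_left)
  next
    case 7
    have less: "x < y + P" if "x \<in> {0..<P}" "y \<in> {0..<P}" for x y
      using that by auto
    have "t\<^sub>1 < t\<^sub>2 \<and> t\<^sub>2 < t\<^sub>3 \<or> t\<^sub>1 < t\<^sub>3 \<and> t\<^sub>3 < t\<^sub>2 \<or> t\<^sub>2 < t\<^sub>1 \<and> t\<^sub>1 < t\<^sub>3 \<or>
        t\<^sub>2 < t\<^sub>3 \<and> t\<^sub>3 < t\<^sub>1 \<or> t\<^sub>3 < t\<^sub>1 \<and> t\<^sub>1 < t\<^sub>2 \<or> t\<^sub>3 < t\<^sub>2 \<and> t\<^sub>2 < t\<^sub>1"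
      using 7(4-6) by linarith
    then show ?thesis
      using fenchel_if_triple[OF _ _ less[OF t(3,1)] 7(1,2,3) zero]
        fenchel_if_triple[OF _ _ less[OF t(2,1)] 7(1,3,2) zeros(1)]
        fenchel_if_triple[OF _ _ less[OF t(3,2)] 7(2,1,3) zeros(2)]
        fenchel_if_triple[OF _ _ less[OF t(1,2)] 7(2,3,1) zeros(3)]
        fenchel_if_triple[OF _ _ less[OF t(2,3)] 7(3,1,2) zeros(4)]
        fenchel_if_triple[OF _ _ less[OF t(1,3)] 7(3,2,1) zeros(5)]
      by blast
  qed
qed

lemma longitude_attained:
  assumes "0 < c" "c < 2 * pi"
  obtains t where "s < t" "t < s + P" "\<Theta> t = \<Theta> s + c"
proof -
  have "\<exists>t. s \<le> t \<and> t \<le> s + P \<and> \<Theta> t = \<Theta> s + c"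
    using assms P_pos by (intro IVT') (auto simp: winding intro: continuous_on_subset[OF cont_longitude])
  then obtain t where t: "s \<le> t" "t \<le> s + P" "\<Theta> t = \<Theta> s + c" by blast
  moreover have "t \<noteq> s" "t \<noteq> s + P" using t(3) assms by (auto simp: winding)
  ultimately show ?thesis using that by force
qed

subsection \<open>Planar loops\<close>

context
  fixes n :: "real^3"
  assumes n: "n \<noteq> 0" and planar: "\<And>t. n \<bullet> T t = 0"
begin

lemma planar': "n \<bullet> T' t = 0"
proof -
  have "((\<lambda>t. n \<bullet> T t) has_vector_derivative n \<bullet> T' t) (at t)"
    by (rule bounded_linear.has_vector_derivative[OF bounded_linear_inner_right deriv])
  then show ?thesis
    unfolding planar using vector_derivative_unique_at[OF has_vector_derivative_const] by metis
qed

text \<open>A horizontal normal would be orthogonal to the direction of every longitude, in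
  particular to two directions a quarter turn apart. With a vertical component, the plane determines
  the latitude from the longitude.\<close>

lemma normal_not_horizontal: "n $ 3 \<noteq> 0"
proof
  assume "n $ 3 = 0"
  then have *: "n $ 1 * T t $ 1 + n $ 2 * T t $ 2 = 0" for t
    using planar[of t] by (simp add: inner_vec_def sum_3)
  have eq: "n $ 1 * cos (\<Theta> t) + n $ 2 * sin (\<Theta> t) = 0" for t
    using arg_cong[OF *[of t], of "\<lambda>x. x * cos (\<psi> t)"] by (simp add: algebra_simps flip: coords)
  obtain t where "\<Theta> t = \<Theta> 0 + pi / 2"
    using longitude_attained[of "pi / 2" 0] pi_gt_zero by auto
  then have "n $ 1 * cos (\<Theta> 0) + n $ 2 * sin (\<Theta> 0) = 0" "n $ 2 * cos (\<Theta> 0) - n $ 1 * sin (\<Theta> 0) = 0"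
    using eq[of 0] eq[of t] by (simp_all add: cos_add sin_add)
  then have "n $ 1 = 0" "n $ 2 = 0"
    using sin_cos_squared_add[of "\<Theta> 0"] by algebra+
  then show False
    using n \<open>n $ 3 = 0\<close> by (simp add: vec_eq_iff forall_3)
qed

lemma planar_sin_latitude:
  "n $ 3 * sin (\<psi> t) = - (n $ 1 * cos (\<Theta> t) + n $ 2 * sin (\<Theta> t))"
proof -
  have "n $ 1 * T t $ 1 + n $ 2 * T t $ 2 + n $ 3 * T t $ 3 = 0"
    using planar[of t] by (simp add: inner_vec_def sum_3)
  from arg_cong[OF this, of "\<lambda>x. x * cos (\<psi> t)"] show ?thesis
    by (simp add: algebra_simps flip: coords)
qed

text \<open>On a planar loop \<open>sin (\<psi> t)\<close> is a linear form in the cosine and sine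
  of the longitude, hence changes sign after half a turn.\<close>

lemma planar_antipodal:
  assumes "\<Theta> t = \<Theta> s + pi"
  shows "T t = - T s"
proof (rule half_turn_antipodal)
  have "n $ 3 * sin (\<psi> t) = n $ 3 * sin (- \<psi> s)"
    using planar_sin_latitude[of s] by (simp add: planar_sin_latitude assms)
  then have "sin (\<psi> t) = sin (- \<psi> s)" using normal_not_horizontal mult_left_cancel by blast
  then show "\<psi> t = - \<psi> s"
    by (rule sin_inj_pi[rotated -1]) (use abs_\<psi>_less[of s] abs_\<psi>_less[of t] in linarith)+
qed (simp add: assms)

text \<open>Half a turn leads to the antipode. All determinants vanish on a planar loop, so both
  halves attain the bound \<open>pi\<close>.\<close>

lemma planar_length: "G P - G 0 = 2 * pi"
proof -
  obtain t where t: "0 < t" "t < P" "\<Theta> t = \<Theta> 0 + pi"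
    using longitude_attained[of pi 0] pi_gt_zero by auto
  have anti: "T t = - T 0" using planar_antipodal t(3) .
  have arcs: "arc 0 t" "arc t (0 + P)"
    using t anti period[of 0] by (auto intro!: antipodal_arc)
  have "G t - G 0 = arccos (lorentz (T 0) (T t))" "G (0 + P) - G t = arccos (lorentz (T t) (T (0 + P)))"
    using arcs by (auto simp: arc_length_eq_iff_left intro!: cross3_triple_eq_0[OF n] planar planar')
  then show ?thesis
    by (simp add: anti period[of 0, simplified] lorentz_minus_left lorentz_minus_right unit)
qed

text \<open>Eliminating the third coordinate by the plane makes the left-hand side a linear form in
  the cosine and sine of \<open>\<Theta> u\<close>. It vanishes at \<open>u = t\<close> and so is a
  multiple of \<open>sin (\<Theta> u - \<Theta> t)\<close>. The factor is not zero, because the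
  derivative of the product at \<open>t\<close> is \<open>lorentz (T' t) (T' t)\<close>.\<close>

lemma lorentz_T':
  obtains R where "R \<noteq> 0" "\<And>u. lorentz (T' t) (T u) * cos (\<psi> u) = R * sin (\<Theta> u - \<Theta> t)"
proof -
  define A B where "A = T' t $ 1 + n $ 1 / n $ 3 * T' t $ 3" and "B = T' t $ 2 + n $ 2 / n $ 3 * T' t $ 3"
  have eq: "lorentz (T' t) (T u) * cos (\<psi> u) = A * cos (\<Theta> u) + B * sin (\<Theta> u)" for u
  proof -
    have 1: "sin (\<psi> u) = - (n $ 1 / n $ 3 * cos (\<Theta> u) + n $ 2 / n $ 3 * sin (\<Theta> u))"
      using planar_sin_latitude[of u] normal_not_horizontal by (simp add: field_simps)
    have 2: "lorentz (T' t) (T u) * cos (\<psi> u) =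
        T' t $ 1 * cos (\<Theta> u) + T' t $ 2 * sin (\<Theta> u) - T' t $ 3 * sin (\<psi> u)"
      by (simp add: lorentz_def algebra_simps flip: coords)
    show ?thesis unfolding 2 1 A_def B_def by (simp add: algebra_simps)
  qed
  define R where "R = B * cos (\<Theta> t) - A * sin (\<Theta> t)"
  have z: "A * cos (\<Theta> t) + B * sin (\<Theta> t) = 0"
    using eq[of t] orthogonal[of t] by (simp add: lorentz_commute)
  have AB: "A = - (R * sin (\<Theta> t))" "B = R * cos (\<Theta> t)"
    using z sin_cos_squared_add[of "\<Theta> t"] unfolding R_def by algebra+
  have R: "lorentz (T' t) (T u) * cos (\<psi> u) = R * sin (\<Theta> u - \<Theta> t)" for u
    unfolding eq by (simp add: AB sin_diff algebra_simps)
  have "R \<noteq> 0"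
  proof
    assume "R = 0"
    then have "lorentz (T' t) (T u) = 0" for u
      using R[of u] cos_\<psi>_pos[of u] by simp
    then have "((\<lambda>u. 0) has_real_derivative lorentz (T' t) (T' t)) (at t)"
      using lorentz_const_has_real_derivative[OF deriv, of "T' t" t] by simp
    then show False
      using DERIV_unique[OF DERIV_const] spacelike'[of t] by force
  qed
  then show ?thesis using that R by blast
qed

text \<open>The height of the curve over its tangent, measured by \<open>\<nu>\<close>, rises during
  the first half turn, falls during the second and returns to its initial value, so it is positive
  in between.\<close>

lemma supporting_normal:
  assumes \<gamma>: "\<And>t. (\<gamma> has_vector_derivative \<sigma> t *\<^sub>R T t) (at t)" and \<sigma>: "\<And>t. \<sigma> t > 0"
    and per: "\<gamma> (t + P) = \<gamma> t"
  obtains \<nu> where "\<nu> \<noteq> 0" "n \<bullet> \<nu> = 0" "lorentz \<nu> (T t) = 0"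
    "\<And>u. t < u \<Longrightarrow> u < t + P \<Longrightarrow> lorentz \<nu> (\<gamma> u - \<gamma> t) > 0"
proof -
  obtain R where R: "R \<noteq> 0" "\<And>u. lorentz (T' t) (T u) * cos (\<psi> u) = R * sin (\<Theta> u - \<Theta> t)"
    using lorentz_T' by blast
  \<comment> \<open>The sign makes the factor in front of the sine positive.\<close>
  define \<nu> where "\<nu> = sgn R *\<^sub>R T' t"
  have sgn: "lorentz \<nu> (T u) > 0 \<longleftrightarrow> sin (\<Theta> u - \<Theta> t) > 0" "lorentz \<nu> (T u) < 0 \<longleftrightarrow> sin (\<Theta> u - \<Theta> t) < 0" for u
  proof -
    have "lorentz \<nu> (T u) * cos (\<psi> u) = \<bar>R\<bar> * sin (\<Theta> u - \<Theta> t)"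
      unfolding abs_sgn[of R] mult.assoc \<nu>_def lorentz_scaleR_left R(2) by (rule mult.left_commute)
    then show "lorentz \<nu> (T u) > 0 \<longleftrightarrow> sin (\<Theta> u - \<Theta> t) > 0" "lorentz \<nu> (T u) < 0 \<longleftrightarrow> sin (\<Theta> u - \<Theta> t) < 0"
      using cos_\<psi>_pos[of u] R(1)
      by (metis mult_less_cancel_right_pos mult_zero_left zero_less_abs_iff mult_less_0_iff zero_less_mult_iff not_less_iff_gr_or_eq)+
  qed
  obtain m where m: "t < m" "m < t + P" "\<Theta> m = \<Theta> t + pi"
    using longitude_attained[of pi t] pi_gt_zero by auto
  let ?h = "\<lambda>u. lorentz \<nu> (\<gamma> u)"
  have h: "(?h has_real_derivative \<sigma> u * lorentz \<nu> (T u)) (at u)" for u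
    using lorentz_const_has_real_derivative[OF \<gamma>] by (simp add: lorentz_scaleR_right)
  have conth: "continuous_on S ?h" for S
    by (rule DERIV_continuous_on, rule has_field_derivative_at_within, rule h)
  have rising: "lorentz \<nu> (T u) > 0" if "t < u" "u < m" for u
    unfolding sgn using longitude_mono[OF that(1)] longitude_mono[OF that(2)] m(3) by (intro sin_gt_zero) auto
  have falling: "lorentz \<nu> (T u) < 0" if "m < u" "u < t + P" for u
    unfolding sgn using longitude_mono[OF that(1)] longitude_mono[OF that(2)] m(3) winding[of t]
    by (intro sin_lt_zero) auto
  have pos: "lorentz \<nu> (\<gamma> u - \<gamma> t) > 0" if "t < u" "u < t + P" for u
  proof (cases "u \<le> m")
    case True
    have "?h t < ?h u"
    proof (rule DERIV_pos_imp_increasing_open[OF that(1) _ conth])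
      fix x assume "t < x" "x < u"
      then show "\<exists>y. (?h has_real_derivative y) (at x) \<and> y > 0"
        using h[of x] rising[of x] \<sigma>[of x] True by (intro exI[of _ "\<sigma> x * lorentz \<nu> (T x)"]) simp
    qed
    then show ?thesis by (simp add: lorentz_diff_right)
  next
    case False
    have "?h u > ?h (t + P)"
    proof (rule DERIV_neg_imp_decreasing_open[OF that(2) _ conth])
      fix x assume "u < x" "x < t + P"
      then show "\<exists>y. (?h has_real_derivative y) (at x) \<and> y < 0"
        using h[of x] falling[of x] \<sigma>[of x] False
        by (intro exI[of _ "\<sigma> x * lorentz \<nu> (T x)"]) (simp add: mult_less_0_iff)
    qed
    then show ?thesis by (simp add: lorentz_diff_right per)
  qed
  have "\<nu> \<noteq> 0"
    using pos[OF m(1,2)] by (auto simp: lorentz_def)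
  moreover have "n \<bullet> \<nu> = 0" by (simp add: \<nu>_def planar')
  moreover have "lorentz \<nu> (T t) = 0"
    using orthogonal[of t] by (simp add: \<nu>_def lorentz_scaleR_left lorentz_commute[of "T' t" "T t"])
  ultimately show ?thesis using that pos by blast
qed

end

end

subsection \<open>The longitude of a spacelike curve\<close>

text \<open>Both pairs solve the same rotation equation. \<open>?E\<close> and \<open>?F\<close> are
  the coordinates of \<open>(c, s)\<close> in the frame rotated by \<open>\<Theta>\<close>, and they
  are constant.\<close>

lemma cos_sin_lift:
  fixes c s c' s' \<omega> \<Theta> :: "real \<Rightarrow> real"
  assumes c: "\<And>t. (c has_real_derivative - \<omega> t * s t) (at t)"
    and s: "\<And>t. (s has_real_derivative \<omega> t * c t) (at t)"
    and \<Theta>: "\<And>t. (\<Theta> has_real_derivative \<omega> t) (at t)"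
    and init: "c 0 = cos (\<Theta> 0)" "s 0 = sin (\<Theta> 0)"
  shows "c t = cos (\<Theta> t)" "s t = sin (\<Theta> t)"
proof -
  let ?E = "\<lambda>t. c t * cos (\<Theta> t) + s t * sin (\<Theta> t)"
  let ?F = "\<lambda>t. s t * cos (\<Theta> t) - c t * sin (\<Theta> t)"
  have "(?E has_real_derivative 0) (at t)" for t
    by (auto intro!: derivative_eq_intros c s \<Theta> simp: algebra_simps)
  then have E: "?E t = ?E 0" using DERIV_isconst_all by blast
  have "(?F has_real_derivative 0) (at t)" for t
    by (auto intro!: derivative_eq_intros c s \<Theta> simp: algebra_simps)
  then have F: "?F t = ?F 0" using DERIV_isconst_all by blast
  have EF: "?E t = 1" "?F t = 0"
    unfolding E F using sin_cos_squared_add3[of "\<Theta> 0"] by (simp_all add: init mult.commute)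
  have "c t = ?E t * cos (\<Theta> t) - ?F t * sin (\<Theta> t)" "s t = ?E t * sin (\<Theta> t) + ?F t * cos (\<Theta> t)"
    using sin_cos_squared_add3[of "\<Theta> t"] by algebra+
  then show "c t = cos (\<Theta> t)" "s t = sin (\<Theta> t)" unfolding EF by simp_all
qed

text \<open>The index supplies a longitude that is only continuous and lives on one period. It is
  replaced by an antiderivative of the angular velocity, which is differentiable on the whole line
  and allows \<open>latitude\<close> to be proved by derivatives.\<close>

lemma longitude_exists:
  fixes T T' :: "real \<Rightarrow> real^3" and \<theta> :: "real \<Rightarrow> real"
  assumes deriv: "\<And>t. (T has_vector_derivative T' t) (at t)"
    and cont': "continuous_on UNIV T'"
    and unit: "\<And>t. lorentz (T t) (T t) = 1"
    and spacelike': "\<And>t. lorentz (T' t) (T' t) > 0"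
    and P: "P > 0" and period: "\<And>t. T (t + P) = T t"
    and \<theta>: "continuous_on {0..P} \<theta>" "\<And>t. t \<in> {0..P} \<Longrightarrow> \<exists>\<phi>. T t = de_sitter_point \<phi> (\<theta> t)"
      "\<theta> P - \<theta> 0 = 2 * pi"
  obtains \<Theta> where "continuous_on UNIV \<Theta>"
    "\<And>t. T t $ 1 = sqrt (1 + (T t $ 3)\<^sup>2) * cos (\<Theta> t)"
    "\<And>t. T t $ 2 = sqrt (1 + (T t $ 3)\<^sup>2) * sin (\<Theta> t)"
    "\<And>t. \<Theta> (t + P) = \<Theta> t + 2 * pi"
    "\<And>s t. s < t \<Longrightarrow> \<bar>arctan (T t $ 3) - arctan (T s $ 3)\<bar> < \<Theta> t - \<Theta> s"
proof -
  define \<rho> where "\<rho> t = sqrt (1 + (T t $ 3)\<^sup>2)" for t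
  define \<omega> where "\<omega> t = (T t $ 1 * T' t $ 2 - T t $ 2 * T' t $ 1) / (\<rho> t)\<^sup>2" for t
  have \<rho>_pos: "\<rho> t > 0" for t by (simp add: \<rho>_def add_pos_nonneg)
  have \<rho>_sq: "(\<rho> t)\<^sup>2 = 1 + (T t $ 3)\<^sup>2" for t by (simp add: \<rho>_def)
  have \<rho>_sq': "(\<rho> t)\<^sup>2 = (T t $ 1)\<^sup>2 + (T t $ 2)\<^sup>2" for t
    using unit[of t] unfolding \<rho>_sq by (simp add: lorentz_def power2_eq_square)
  have T3: "T t $ 3 * T' t $ 3 = T t $ 1 * T' t $ 1 + T t $ 2 * T' t $ 2" for t
    using lorentz_orthogonal_derivative[OF deriv unit, of t] by (simp add: lorentz_def)
  note comp = has_real_derivative_component[OF deriv]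
  have contT: "continuous_on UNIV T"
    by (meson continuous_at_imp_continuous_on deriv has_vector_derivative_continuous)
  have cont\<omega>: "continuous_on UNIV \<omega>"
    unfolding \<omega>_def \<rho>_sq
    by (intro continuous_intros contT cont') (simp add: add_nonneg_eq_0_iff)
  then obtain H where H: "\<And>t. (H has_real_derivative \<omega> t) (at t)"
    using antiderivative_exists by blast
  define \<Theta> where "\<Theta> t = H t - H 0 + \<theta> 0" for t
  have \<Theta>: "(\<Theta> has_real_derivative \<omega> t) (at t)" for t
    unfolding \<Theta>_def by (auto intro!: derivative_eq_intros H)
  have cont\<Theta>: "continuous_on S \<Theta>" for S
    by (rule DERIV_continuous_on, rule has_field_derivative_at_within, rule \<Theta>)
  have \<rho>': "(\<rho> has_real_derivative T t $ 3 * T' t $ 3 / \<rho> t) (at t)" for t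
    unfolding \<rho>_def using \<rho>_pos[of t]
    by (auto intro!: derivative_eq_intros comp simp: \<rho>_def field_simps)
  \<comment> \<open>The horizontal direction of \<open>T\<close> is a point of the unit circle that
    turns with angular velocity \<open>\<omega>\<close>.\<close>
  have c: "((\<lambda>t. T t $ 1 / \<rho> t) has_real_derivative - \<omega> t * (T t $ 2 / \<rho> t)) (at t)"
    and s: "((\<lambda>t. T t $ 2 / \<rho> t) has_real_derivative \<omega> t * (T t $ 1 / \<rho> t)) (at t)" for t
  proof -
    have "((\<lambda>t. T t $ 1 / \<rho> t) has_real_derivative
        (T' t $ 1 * \<rho> t - T t $ 1 * (T t $ 3 * T' t $ 3 / \<rho> t)) / (\<rho> t * \<rho> t)) (at t)"
      "((\<lambda>t. T t $ 2 / \<rho> t) has_real_derivative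
        (T' t $ 2 * \<rho> t - T t $ 2 * (T t $ 3 * T' t $ 3 / \<rho> t)) / (\<rho> t * \<rho> t)) (at t)"
      using \<rho>_pos[of t] DERIV_divide[OF comp \<rho>'] by auto
    moreover have "(T' t $ 1 * \<rho> t - T t $ 1 * (T t $ 3 * T' t $ 3 / \<rho> t)) / (\<rho> t * \<rho> t) = - \<omega> t * (T t $ 2 / \<rho> t)"
      "(T' t $ 2 * \<rho> t - T t $ 2 * (T t $ 3 * T' t $ 3 / \<rho> t)) / (\<rho> t * \<rho> t) = \<omega> t * (T t $ 1 / \<rho> t)"
    proof -
      have "(T' t $ 1 * \<rho> t - T t $ 1 * (T t $ 3 * T' t $ 3 / \<rho> t)) / (\<rho> t * \<rho> t)
          = (T' t $ 1 * (\<rho> t)\<^sup>2 - T t $ 1 * (T t $ 3 * T' t $ 3)) / (\<rho> t)^3"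
        "(T' t $ 2 * \<rho> t - T t $ 2 * (T t $ 3 * T' t $ 3 / \<rho> t)) / (\<rho> t * \<rho> t)
          = (T' t $ 2 * (\<rho> t)\<^sup>2 - T t $ 2 * (T t $ 3 * T' t $ 3)) / (\<rho> t)^3"
        using \<rho>_pos[of t] by (simp_all add: field_simps power2_eq_square power3_eq_cube)
      moreover have "- \<omega> t * (T t $ 2 / \<rho> t) = - ((T t $ 1 * T' t $ 2 - T t $ 2 * T' t $ 1) * T t $ 2) / (\<rho> t)^3"
        "\<omega> t * (T t $ 1 / \<rho> t) = (T t $ 1 * T' t $ 2 - T t $ 2 * T' t $ 1) * T t $ 1 / (\<rho> t)^3"
        unfolding \<omega>_def minus_divide_left[symmetric] mult_minus_left
        by (simp_all add: power2_eq_square power3_eq_cube)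
      moreover have "T' t $ 1 * (\<rho> t)\<^sup>2 - T t $ 1 * (T t $ 3 * T' t $ 3) = - ((T t $ 1 * T' t $ 2 - T t $ 2 * T' t $ 1) * T t $ 2)"
        "T' t $ 2 * (\<rho> t)\<^sup>2 - T t $ 2 * (T t $ 3 * T' t $ 3) = (T t $ 1 * T' t $ 2 - T t $ 2 * T' t $ 1) * T t $ 1"
        unfolding \<rho>_sq' T3 by (simp_all add: power2_eq_square algebra_simps)
      ultimately show "(T' t $ 1 * \<rho> t - T t $ 1 * (T t $ 3 * T' t $ 3 / \<rho> t)) / (\<rho> t * \<rho> t) = - \<omega> t * (T t $ 2 / \<rho> t)"
        "(T' t $ 2 * \<rho> t - T t $ 2 * (T t $ 3 * T' t $ 3 / \<rho> t)) / (\<rho> t * \<rho> t) = \<omega> t * (T t $ 1 / \<rho> t)"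
        by simp_all
    qed
    ultimately show "((\<lambda>t. T t $ 1 / \<rho> t) has_real_derivative - \<omega> t * (T t $ 2 / \<rho> t)) (at t)"
      "((\<lambda>t. T t $ 2 / \<rho> t) has_real_derivative \<omega> t * (T t $ 1 / \<rho> t)) (at t)"
      by simp_all
  qed
  have \<theta>_coords: "T t $ 1 / \<rho> t = cos (\<theta> t)" "T t $ 2 / \<rho> t = sin (\<theta> t)" if t: "t \<in> {0..P}" for t
  proof -
    obtain \<phi> where \<phi>: "T t = de_sitter_point \<phi> (\<theta> t)" using \<theta>(2)[OF t] by blast
    have "\<rho> t = cosh \<phi>"
      by (simp add: \<rho>_def \<phi> de_sitter_point_def cosh_square_eq[symmetric] add.commute[of 1])
    then show "T t $ 1 / \<rho> t = cos (\<theta> t)" "T t $ 2 / \<rho> t = sin (\<theta> t)"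
      by (simp_all add: \<phi> de_sitter_point_def)
  qed
  have lift: "T t $ 1 / \<rho> t = cos (\<Theta> t)" "T t $ 2 / \<rho> t = sin (\<Theta> t)" for t
    using cos_sin_lift[of "\<lambda>t. T t $ 1 / \<rho> t" \<omega> "\<lambda>t. T t $ 2 / \<rho> t" \<Theta>, OF c s \<Theta>] \<theta>_coords[of 0] P
    by (simp_all add: \<Theta>_def)
  \<comment> \<open>Two longitudes differ by a continuous function with values in the multiples of
    \<open>2 * pi\<close>, which is constant.\<close>
  have total: "\<Theta> P - \<Theta> 0 = 2 * pi"
  proof -
    have "(\<lambda>t. \<Theta> t - \<theta> t) constant_on {0..P}"
    proof (rule continuous_discrete_range_constant)
      show "continuous_on {0..P} (\<lambda>t. \<Theta> t - \<theta> t)"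
        by (intro continuous_intros cont\<Theta> \<theta>(1))
      fix x assume x: "x \<in> {0..P}"
      have multiple: "\<exists>k::int. \<Theta> t = \<theta> t + 2 * pi * k" if "t \<in> {0..P}" for t
        using sin_cos_eq_iff[of "\<Theta> t" "\<theta> t"] lift[of t] \<theta>_coords[OF that] by auto
      have "2 * pi \<le> norm ((\<Theta> y - \<theta> y) - (\<Theta> x - \<theta> x))"
        if y: "y \<in> {0..P}" "\<Theta> y - \<theta> y \<noteq> \<Theta> x - \<theta> x" for y
      proof -
        obtain k l :: int where k: "\<Theta> y = \<theta> y + 2 * pi * k" "\<Theta> x = \<theta> x + 2 * pi * l"
          using multiple x y(1) by blast
        have "k \<noteq> l" using k y(2) by auto
        then have "1 \<le> \<bar>k - l\<bar>" by simp
        then have "1 \<le> \<bar>real_of_int k - real_of_int l\<bar>" by linarith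
        then have "2 * pi * 1 \<le> 2 * pi * \<bar>real_of_int k - real_of_int l\<bar>"
          by (intro mult_left_mono) auto
        also have "\<dots> = norm ((\<Theta> y - \<theta> y) - (\<Theta> x - \<theta> x))"
          unfolding k by (simp add: abs_mult flip: right_diff_distrib)
        finally show ?thesis by simp
      qed
      then show "\<exists>e>0. \<forall>y. y \<in> {0..P} \<and> \<Theta> y - \<theta> y \<noteq> \<Theta> x - \<theta> x \<longrightarrow> e \<le> norm ((\<Theta> y - \<theta> y) - (\<Theta> x - \<theta> x))"
        by (intro exI[of _ "2 * pi"]) auto
    qed simp
    then have "\<Theta> P - \<theta> P = \<Theta> 0 - \<theta> 0"
      unfolding constant_on_def using P by force
    then show ?thesis using \<theta>(3) by simp
  qed
  have winding: "\<Theta> (t + P) = \<Theta> t + 2 * pi" for t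
  proof -
    have "\<omega> (t + P) = \<omega> t" for t
      using has_vector_derivative_periodic[of T, OF deriv period] by (simp add: \<omega>_def \<rho>_def period)
    then have "((\<lambda>t. \<Theta> (t + P)) has_real_derivative \<omega> t) (at t)" for t
      using \<Theta>[of "t + P"] by (simp add: DERIV_shift)
    then have "((\<lambda>t. \<Theta> (t + P) - \<Theta> t) has_real_derivative 0) (at t)" for t
      using DERIV_diff[OF _ \<Theta>] by fastforce
    then have "\<Theta> (t + P) - \<Theta> t = \<Theta> (0 + P) - \<Theta> 0"
      using DERIV_isconst_all[of "\<lambda>t. \<Theta> (t + P) - \<Theta> t" t 0] by blast
    then show ?thesis using total by simp
  qed
  \<comment> \<open>By Lagrange's identity the squared angular momentum exceeds the squared vertical
    velocity by \<open>(\<rho> t)\<^sup>2 * lorentz (T' t) (T' t)\<close>, which is positive because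
    \<open>T'\<close> is spacelike.\<close>
  have key: "(\<omega> t * (\<rho> t)\<^sup>2)\<^sup>2 > (T' t $ 3)\<^sup>2" for t
  proof -
    have "(\<omega> t * (\<rho> t)\<^sup>2)\<^sup>2 = (T t $ 1 * T' t $ 2 - T t $ 2 * T' t $ 1)\<^sup>2"
      using \<rho>_pos[of t] by (simp add: \<omega>_def)
    also have "\<dots> = ((T t $ 1)\<^sup>2 + (T t $ 2)\<^sup>2) * ((T' t $ 1)\<^sup>2 + (T' t $ 2)\<^sup>2)
        - (T t $ 1 * T' t $ 1 + T t $ 2 * T' t $ 2)\<^sup>2"
      by (simp add: power2_eq_square algebra_simps)
    also have "\<dots> = (\<rho> t)\<^sup>2 * (lorentz (T' t) (T' t) + (T' t $ 3)\<^sup>2) - (T t $ 3 * T' t $ 3)\<^sup>2"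
      unfolding \<rho>_sq' T3 by (simp add: lorentz_def power2_eq_square)
    also have "\<dots> = (\<rho> t)\<^sup>2 * lorentz (T' t) (T' t) + (T' t $ 3)\<^sup>2"
      unfolding \<rho>_sq by (simp add: power2_eq_square algebra_simps)
    finally show ?thesis using \<rho>_pos[of t] spacelike'[of t] by simp
  qed
  \<comment> \<open>The angular velocity never vanishes and is positive somewhere by the mean value
    theorem, as the total turn is \<open>2 * pi\<close>.\<close>
  have \<omega>_pos: "\<omega> t > 0" for t
  proof -
    have nz: "\<omega> t \<noteq> 0" for t using key[of t] by auto
    obtain z where "\<Theta> P - \<Theta> 0 = (P - 0) * \<omega> z" using MVT2[OF P, of \<Theta> \<omega>] \<Theta> by blast
    then have "P * \<omega> z = 2 * pi" using total by simp
    then have "0 < P * \<omega> z" by simp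
    then have z: "\<omega> z > 0" using P by (simp add: zero_less_mult_iff)
    have conn: "connected (range \<omega>)" using cont\<omega> by (intro connected_continuous_image) auto
    show ?thesis
    proof (rule ccontr)
      assume "\<not> ?thesis"
      then have "0 \<in> range \<omega>"
        using conn z unfolding connected_iff_interval by (meson less_imp_le linorder_not_less rangeI)
      then show False using nz by (metis imageE)
    qed
  qed
  have "\<bar>T' t $ 3 / (\<rho> t)\<^sup>2\<bar> < \<omega> t" for t
  proof -
    have "\<bar>T' t $ 3\<bar> < \<bar>\<omega> t * (\<rho> t)\<^sup>2\<bar>"
      using key[of t] by (metis abs_le_square_iff linorder_not_less)
    then show ?thesis
      using \<omega>_pos[of t] \<rho>_pos[of t] by (simp add: abs_mult field_simps)
  qed
  moreover have \<psi>: "((\<lambda>t. arctan (T t $ 3)) has_real_derivative T' t $ 3 / (\<rho> t)\<^sup>2) (at t)" for t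
    unfolding \<rho>_sq by (auto intro!: derivative_eq_intros comp simp: field_simps)
  \<comment> \<open>These are the derivatives of the null coordinates, the sum and the difference of
    longitude and conformal latitude; both coordinates increase strictly.\<close>
  ultimately have slope: "\<omega> t + T' t $ 3 / (\<rho> t)\<^sup>2 > 0" "\<omega> t - T' t $ 3 / (\<rho> t)\<^sup>2 > 0" for t
    by (smt (verit))+
  have latitude: "\<bar>arctan (T t $ 3) - arctan (T s $ 3)\<bar> < \<Theta> t - \<Theta> s" if "s < t" for s t
  proof -
    have "\<Theta> s + arctan (T s $ 3) < \<Theta> t + arctan (T t $ 3)"
      by (rule DERIV_pos_imp_increasing[OF that]) (use slope(1) DERIV_add[OF \<Theta> \<psi>] in blast)
    moreover have "\<Theta> s - arctan (T s $ 3) < \<Theta> t - arctan (T t $ 3)"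
      by (rule DERIV_pos_imp_increasing[OF that]) (use slope(2) DERIV_diff[OF \<Theta> \<psi>] in blast)
    ultimately show ?thesis by linarith
  qed
  show ?thesis
  proof (rule that[OF cont\<Theta> _ _ winding latitude])
    fix t show "T t $ 1 = sqrt (1 + (T t $ 3)\<^sup>2) * cos (\<Theta> t)" "T t $ 2 = sqrt (1 + (T t $ 3)\<^sup>2) * sin (\<Theta> t)"
      using lift[of t] \<rho>_pos[of t] by (simp_all add: \<rho>_def field_simps)
  qed
qed

subsection \<open>The tangent indicatrix\<close>

context
  fixes \<gamma> :: "real \<Rightarrow> real^3" and P :: real
  assumes strong: "strong_spacelike_curve \<gamma>" and closed: "closed_curve \<gamma> P"
begin

lemma smooth: "(velocity ^^ k) \<gamma> differentiable (at t)"
  using strong unfolding strong_spacelike_curve_def spacelike_curve_def smooth_curve_def by blast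

lemma velocity_deriv:
  "(\<gamma> has_vector_derivative velocity \<gamma> t) (at t)"
  "(velocity \<gamma> has_vector_derivative velocity (velocity \<gamma>) t) (at t)"
  "velocity (velocity \<gamma>) differentiable (at t)"
  using smooth[of 0 t] smooth[of 1 t] smooth[of 2 t]
  by (simp_all add: velocity_def[of _ t] vector_derivative_works[symmetric] numeral_2_eq_2)

lemma velocity_pos: "lorentz (velocity \<gamma> t) (velocity \<gamma> t) > 0"
  using strong span_base[of "velocity \<gamma> t" "{velocity \<gamma> t}"]
  unfolding strong_spacelike_curve_def spacelike_curve_def spacelike_subspace_def by blast

lemma speed_pos: "speed \<gamma> t > 0"
  unfolding speed_def using velocity_pos by simp

lemma unit_tangent_eq: "unit_tangent \<gamma> t = (1 / speed \<gamma> t) *\<^sub>R velocity \<gamma> t"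
  by (simp add: unit_tangent_def arclength_deriv_def velocity_def)

lemma velocity_eq: "velocity \<gamma> t = speed \<gamma> t *\<^sub>R unit_tangent \<gamma> t"
  using speed_pos[of t] by (simp add: unit_tangent_eq)

text \<open>The quotient rule for velocity over speed, written out so that its continuity can be
  read off.\<close>

definition tangent_deriv :: "real \<Rightarrow> real^3" where
  "tangent_deriv t = (1 / speed \<gamma> t) *\<^sub>R velocity (velocity \<gamma>) t
     - (lorentz (velocity \<gamma> t) (velocity (velocity \<gamma>) t) / speed \<gamma> t ^ 3) *\<^sub>R velocity \<gamma> t"

lemma speed_deriv:
  "(speed \<gamma> has_real_derivative lorentz (velocity \<gamma> t) (velocity (velocity \<gamma>) t) / speed \<gamma> t) (at t)"
  unfolding speed_def using velocity_pos[of t]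
  by (auto intro!: derivative_eq_intros lorentz_has_real_derivative velocity_deriv
      simp: lorentz_commute[of "velocity (velocity \<gamma>) t"] field_simps)

lemma unit_tangent_deriv: "(unit_tangent \<gamma> has_vector_derivative tangent_deriv t) (at t)"
proof -
  have "((\<lambda>t. 1 / speed \<gamma> t) has_real_derivative
      - (lorentz (velocity \<gamma> t) (velocity (velocity \<gamma>) t) / speed \<gamma> t ^ 3)) (at t)"
    using speed_pos[of t]
    by (auto intro!: derivative_eq_intros speed_deriv simp: field_simps power3_eq_cube)
  from has_vector_derivative_scaleR[OF this velocity_deriv(2)[of t]]
  show ?thesis
    unfolding tangent_deriv_def unit_tangent_eq[abs_def] by simp
qed

lemma continuous_on_tangent_deriv: "continuous_on UNIV tangent_deriv"
proof -
  have "continuous_on UNIV (velocity \<gamma>)" "continuous_on UNIV (velocity (velocity \<gamma>))"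
    using velocity_deriv(2,3)
    by (meson continuous_at_imp_continuous_on has_vector_derivative_continuous differentiable_imp_continuous_within)+
  moreover from this have "continuous_on UNIV (speed \<gamma>)"
    unfolding speed_def by (intro continuous_intros)
  moreover have "speed \<gamma> t \<noteq> 0" for t using speed_pos[of t] by simp
  ultimately show ?thesis
    unfolding tangent_deriv_def by (intro continuous_intros) auto
qed

lemma unit_tangent_unit: "lorentz (unit_tangent \<gamma> t) (unit_tangent \<gamma> t) = 1"
  using velocity_pos[of t]
  by (simp add: unit_tangent_eq lorentz_scaleR_left lorentz_scaleR_right speed_def field_simps)

lemma curvature_vector_eq: "curvature_vector \<gamma> t = (1 / speed \<gamma> t) *\<^sub>R tangent_deriv t"
  using unit_tangent_deriv[of t]
  by (simp add: curvature_vector_def arclength_deriv_def vector_derivative_at)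

text \<open>The integrand of the total curvature is the length element of the tangent
  indicatrix.\<close>

lemma curvature_speed: "curvature \<gamma> t * speed \<gamma> t = sqrt (lorentz (tangent_deriv t) (tangent_deriv t))"
  using speed_pos[of t]
  by (simp add: curvature_def curvature_vector_eq lorentz_scaleR_left lorentz_scaleR_right
      real_sqrt_divide real_sqrt_mult)

text \<open>The spacelike osculating plane contains the nonzero curvature vector, of which
  \<open>tangent_deriv\<close> is a positive multiple.\<close>

lemma tangent_deriv_pos: "lorentz (tangent_deriv t) (tangent_deriv t) > 0"
proof -
  have "curvature_vector \<gamma> t \<in> osculating_plane \<gamma> t"
    unfolding osculating_plane_def by (intro span_base) simp
  then have "lorentz (curvature_vector \<gamma> t) (curvature_vector \<gamma> t) > 0"
    using strong unfolding strong_spacelike_curve_def spacelike_subspace_def by blast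
  then show ?thesis
    using speed_pos[of t]
    by (simp add: curvature_vector_eq lorentz_scaleR_left lorentz_scaleR_right zero_less_divide_iff zero_less_mult_iff)
qed

section \<open>Consequences of closedness\<close>

lemma P_pos: "P > 0" and curve_period: "\<gamma> (t + P) = \<gamma> t"
  using closed unfolding closed_curve_def by auto

lemma unit_tangent_period: "unit_tangent \<gamma> (t + P) = unit_tangent \<gamma> t"
  using has_vector_derivative_periodic[of \<gamma> "velocity \<gamma>", OF velocity_deriv(1) curve_period]
  by (simp add: unit_tangent_eq speed_def)

text \<open>Otherwise \<open>\<gamma>\<close> would be strictly monotone in the direction of a separating normal.\<close>

lemma zero_in_tangent_hull: "0 \<in> convex hull (range (unit_tangent \<gamma>))"
proof (rule ccontr)
  assume nin: "0 \<notin> convex hull (range (unit_tangent \<gamma>))"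
  have "continuous_on UNIV (unit_tangent \<gamma>)"
    by (meson continuous_at_imp_continuous_on unit_tangent_deriv has_vector_derivative_continuous)
  then have "compact (unit_tangent \<gamma> ` {0..P})"
    by (meson compact_Icc compact_continuous_image continuous_on_subset subset_UNIV)
  moreover have "range (unit_tangent \<gamma>) = unit_tangent \<gamma> ` {0..P}"
  proof (intro equalityI subsetI)
    fix x assume "x \<in> range (unit_tangent \<gamma>)"
    then obtain u where "x = unit_tangent \<gamma> u" by blast
    moreover obtain s where "s \<in> {0..<0 + P}" "unit_tangent \<gamma> u = unit_tangent \<gamma> s"
      using periodic_reduce[of P "unit_tangent \<gamma>" 0 u, OF P_pos unit_tangent_period] .
    ultimately show "x \<in> unit_tangent \<gamma> ` {0..P}" by auto
  qed auto
  ultimately have "closed (convex hull (range (unit_tangent \<gamma>)))"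
    by (simp add: compact_convex_hull compact_imp_closed)
  from separating_hyperplane_closed_0[OF convex_convex_hull this nin]
  obtain a b where "0 < b" "\<forall>x\<in>convex hull (range (unit_tangent \<gamma>)). a \<bullet> x > b" by blast
  then have pos: "a \<bullet> unit_tangent \<gamma> t > 0" for t
    using hull_inc[of "unit_tangent \<gamma> t" "range (unit_tangent \<gamma>)" convex] by fastforce
  have "a \<bullet> \<gamma> 0 < a \<bullet> \<gamma> P"
  proof (rule DERIV_pos_imp_increasing[OF P_pos])
    fix t
    have "((\<lambda>t. a \<bullet> \<gamma> t) has_real_derivative a \<bullet> velocity \<gamma> t) (at t)"
      using bounded_linear.has_vector_derivative[OF bounded_linear_inner_right velocity_deriv(1)]
      by (simp add: has_real_derivative_iff_has_vector_derivative)
    moreover have "a \<bullet> velocity \<gamma> t > 0"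
      using pos[of t] speed_pos[of t] by (simp add: velocity_eq)
    ultimately show "\<exists>y. ((\<lambda>t. a \<bullet> \<gamma> t) has_real_derivative y) (at t) \<and> 0 < y" by blast
  qed
  then show False using curve_period[of 0] by simp
qed

lemma tangent_indicatrix_loop:
  assumes "has_index \<gamma> P 1"
  obtains G \<Theta> where "de_sitter_loop (unit_tangent \<gamma>) tangent_deriv G \<Theta> P"
    "total_curvature \<gamma> P = G P - G 0"
proof -
  obtain \<theta> where \<theta>: "continuous_on {0..P} \<theta>"
    "\<And>t. t \<in> {0..P} \<Longrightarrow> \<exists>\<phi>. unit_tangent \<gamma> t = de_sitter_point \<phi> (\<theta> t)" "\<theta> P - \<theta> 0 = 2 * pi"
    using assms unfolding has_index_def by auto
  obtain \<Theta> where \<Theta>: "continuous_on UNIV \<Theta>"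
    "\<And>t. unit_tangent \<gamma> t $ 1 = sqrt (1 + (unit_tangent \<gamma> t $ 3)\<^sup>2) * cos (\<Theta> t)"
    "\<And>t. unit_tangent \<gamma> t $ 2 = sqrt (1 + (unit_tangent \<gamma> t $ 3)\<^sup>2) * sin (\<Theta> t)"
    "\<And>t. \<Theta> (t + P) = \<Theta> t + 2 * pi"
    "\<And>s t. s < t \<Longrightarrow> \<bar>arctan (unit_tangent \<gamma> t $ 3) - arctan (unit_tangent \<gamma> s $ 3)\<bar> < \<Theta> t - \<Theta> s"
    using longitude_exists[OF unit_tangent_deriv continuous_on_tangent_deriv unit_tangent_unit
        tangent_deriv_pos P_pos unit_tangent_period \<theta>] by blast
  have "continuous_on UNIV (\<lambda>t. sqrt (lorentz (tangent_deriv t) (tangent_deriv t)))"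
    by (intro continuous_intros continuous_on_tangent_deriv)
  then obtain G where G: "\<And>t. (G has_real_derivative sqrt (lorentz (tangent_deriv t) (tangent_deriv t))) (at t)"
    using antiderivative_exists by blast
  have "de_sitter_loop (unit_tangent \<gamma>) tangent_deriv G \<Theta> P"
    by unfold_locales (fact unit_tangent_deriv continuous_on_tangent_deriv unit_tangent_unit
        tangent_deriv_pos G P_pos unit_tangent_period \<Theta>)+
  moreover have "((\<lambda>t. sqrt (lorentz (tangent_deriv t) (tangent_deriv t))) has_integral G P - G 0) {0..P}"
    using G P_pos
    by (intro fundamental_theorem_of_calculus)
      (auto simp flip: has_real_derivative_iff_has_vector_derivative intro: has_field_derivative_at_within)
  then have "total_curvature \<gamma> P = G P - G 0"
    unfolding total_curvature_def curvature_speed by (rule integral_unique)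
  ultimately show ?thesis using that by blast
qed

text \<open>The derivative of \<open>n \<bullet> \<gamma> t\<close> is the positive speed times
  \<open>n \<bullet> unit_tangent \<gamma> t\<close>. A plane of the curve thus corresponds to the
  parallel plane through the origin for the indicatrix.\<close>

lemma planar_curve_iff:
  "(\<forall>t. n \<bullet> \<gamma> t = n \<bullet> \<gamma> 0) \<longleftrightarrow> (\<forall>t. n \<bullet> unit_tangent \<gamma> t = 0)"
proof -
  have deriv: "((\<lambda>t. n \<bullet> \<gamma> t) has_real_derivative speed \<gamma> t * (n \<bullet> unit_tangent \<gamma> t)) (at t)" for t
    using bounded_linear.has_vector_derivative[OF bounded_linear_inner_right velocity_deriv(1)[of t]]
    by (simp add: has_real_derivative_iff_has_vector_derivative velocity_eq)
  show ?thesis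
  proof (intro iffI allI)
    fix t assume "\<forall>t. n \<bullet> \<gamma> t = n \<bullet> \<gamma> 0"
    then have "(\<lambda>t. n \<bullet> \<gamma> t) = (\<lambda>_. n \<bullet> \<gamma> 0)" by blast
    then have "((\<lambda>_. n \<bullet> \<gamma> 0) has_real_derivative speed \<gamma> t * (n \<bullet> unit_tangent \<gamma> t)) (at t)"
      using deriv[of t] by (simp only:)
    then show "n \<bullet> unit_tangent \<gamma> t = 0"
      using DERIV_unique[OF DERIV_const] speed_pos[of t] by force
  next
    fix t assume "\<forall>t. n \<bullet> unit_tangent \<gamma> t = 0"
    then show "n \<bullet> \<gamma> t = n \<bullet> \<gamma> 0"
      using deriv DERIV_isconst_all[of "\<lambda>t. n \<bullet> \<gamma> t" t 0] by simp
  qed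
qed

text \<open>In the case of equality the plane is the one through \<open>\<gamma> 0\<close> parallel
  to an osculating plane, hence spacelike.\<close>

lemma total_curvature_le_and_eq_iff:
  assumes "has_index \<gamma> P 1"
  shows "total_curvature \<gamma> P \<le> 2 * pi \<and>
    (total_curvature \<gamma> P = 2 * pi \<longleftrightarrow> (\<exists>A. spacelike_plane A \<and> convex_curve_in A \<gamma> P))"
proof -
  let ?T = "unit_tangent \<gamma>"
  obtain G \<Theta> where loop: "de_sitter_loop ?T tangent_deriv G \<Theta> P"
    and total: "total_curvature \<gamma> P = G P - G 0"
    using tangent_indicatrix_loop[OF assms] .
  interpret de_sitter_loop ?T tangent_deriv G \<Theta> P by (fact loop)
  have fenchel: fenchel by (rule fenchel_if_zero_in_hull[OF zero_in_tangent_hull])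
  have "\<exists>A. spacelike_plane A \<and> convex_curve_in A \<gamma> P" if full: "total_curvature \<gamma> P = 2 * pi"
  proof -
    obtain t\<^sub>0 where t\<^sub>0: "\<And>t. ?T t \<bullet> cross3 (?T t\<^sub>0) (tangent_deriv t\<^sub>0) = 0"
      using fenchel full unfolding fenchel_def total by blast
    define n where "n = cross3 (?T t\<^sub>0) (tangent_deriv t\<^sub>0)"
    have n: "n \<noteq> 0" "\<And>t. n \<bullet> ?T t = 0"
      using cross3_nonzero t\<^sub>0 by (simp_all add: n_def inner_commute)
    define A where "A = {x. n \<bullet> x = n \<bullet> \<gamma> 0}"
    have range: "range \<gamma> \<subseteq> A"
      using planar_curve_iff[of n] n(2) by (auto simp: A_def)
    have "direction A = {x. n \<bullet> x = 0}" unfolding A_def by (rule direction_hyperplane) (rule refl)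
    also have "\<dots> = osculating_plane \<gamma> t\<^sub>0"
      unfolding osculating_plane_def
    proof (rule hyperplane_eq_span)
      show "n \<bullet> curvature_vector \<gamma> t\<^sub>0 = 0" by (simp add: curvature_vector_eq n_def dot_cross_self)
      show "dim (span {?T t\<^sub>0, curvature_vector \<gamma> t\<^sub>0}) = 2"
        using strong unfolding strong_spacelike_curve_def osculating_plane_def by blast
    qed (use n in auto)
    finally have "spacelike_subspace (direction A)"
      using strong unfolding strong_spacelike_curve_def by simp
    moreover have "affine A" "aff_dim A = 2"
      using n(1) by (simp_all add: A_def affine_hyperplane aff_dim_hyperplane)
    ultimately have "spacelike_plane A" by (simp add: spacelike_plane_def)
    \<comment> \<open>Strict positivity within a period yields both simplicity of the curve and the
      supporting half-planes.\<close>
    have normal: "\<exists>\<nu>\<in>direction A. \<nu> \<noteq> 0 \<and> lorentz \<nu> (velocity \<gamma> t) = 0 \<and>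
        (\<forall>u. t < u \<longrightarrow> u < t + P \<longrightarrow> lorentz \<nu> (\<gamma> u - \<gamma> t) > 0)" for t
    proof -
      obtain \<nu> where "\<nu> \<noteq> 0" "n \<bullet> \<nu> = 0" "lorentz \<nu> (?T t) = 0"
        "\<And>u. t < u \<Longrightarrow> u < t + P \<Longrightarrow> lorentz \<nu> (\<gamma> u - \<gamma> t) > 0"
        using supporting_normal[OF n, of \<gamma> "speed \<gamma>" t] velocity_deriv(1) velocity_eq speed_pos curve_period
        by metis
      then show ?thesis
        unfolding \<open>direction A = {x. n \<bullet> x = 0}\<close>
        by (intro bexI[of _ \<nu>]) (auto simp: velocity_eq[of t] lorentz_scaleR_right)
    qed
    have "convex_curve_in A \<gamma> P"
      unfolding convex_curve_in_def
    proof (intro conjI allI range)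
      have less: "\<gamma> s \<noteq> \<gamma> t" if st: "s \<in> {0..<P}" "t \<in> {0..<P}" "s < t" for s t
      proof -
        have "t < s + P" using st by simp
        then obtain \<nu> where "lorentz \<nu> (\<gamma> t - \<gamma> s) > 0" using normal[of s] st by blast
        then show ?thesis by (auto simp: lorentz_0_right)
      qed
      then show "inj_on \<gamma> {0..<P}"
        by (metis inj_onI linorder_less_linear)
      fix t
      obtain \<nu> where \<nu>: "\<nu> \<in> direction A" "\<nu> \<noteq> 0" "lorentz \<nu> (velocity \<gamma> t) = 0"
        "\<And>u. t < u \<Longrightarrow> u < t + P \<Longrightarrow> lorentz \<nu> (\<gamma> u - \<gamma> t) > 0"
        using normal[of t] by blast
      have "lorentz \<nu> (\<gamma> u - \<gamma> t) \<ge> 0" for u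
      proof -
        obtain s where s: "s \<in> {t..<t + P}" "\<gamma> u = \<gamma> s"
          using periodic_reduce[of P \<gamma> t u, OF P_pos curve_period] .
        then show ?thesis
          using \<nu>(4)[of s] by (cases "s = t") (auto simp: lorentz_0_right)
      qed
      then show "\<exists>\<nu>\<in>direction A. \<nu> \<noteq> 0 \<and> lorentz \<nu> (velocity \<gamma> t) = 0 \<and> (\<forall>u. lorentz \<nu> (\<gamma> u - \<gamma> t) \<ge> 0)"
        using \<nu> by blast
    qed
    then show ?thesis using \<open>spacelike_plane A\<close> by blast
  qed
  \<comment> \<open>A plane containing the curve is a hyperplane whose normal annihilates the
    indicatrix, so \<open>planar_length\<close> applies.\<close>
  moreover have "total_curvature \<gamma> P = 2 * pi" if A: "spacelike_plane A" "range \<gamma> \<subseteq> A" for A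
  proof -
    have hull: "affine hull A = A" and dim: "aff_dim A = int (DIM(real^3) - 1)"
      using A(1) by (simp_all add: spacelike_plane_def)
    obtain n b where n: "n \<noteq> 0" "A = {x. n \<bullet> x = b}"
      using iffD1[OF aff_dim_eq_hyperplane dim] unfolding hull by blast
    then have "n \<bullet> \<gamma> t = n \<bullet> \<gamma> 0" for t
      using A(2) by (metis (mono_tags, lifting) mem_Collect_eq rangeI subsetD)
    then have "n \<bullet> ?T t = 0" for t
      using planar_curve_iff[of n] by blast
    then show ?thesis
      using planar_length[OF n(1)] by (simp add: total)
  qed
  ultimately show ?thesis
    using fenchel unfolding fenchel_def total convex_curve_in_def by blast
qed

end

theorem theorem1p1:
  fixes \<gamma> :: "real \<Rightarrow> real^3" and P :: real
  assumes "strong_spacelike_curve \<gamma>"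
    and "closed_curve \<gamma> P"
    and "has_index \<gamma> P 1"
  shows "total_curvature \<gamma> P \<le> 2 * pi \<and>
    (total_curvature \<gamma> P = 2 * pi \<longleftrightarrow>
      (\<exists>A. spacelike_plane A \<and> convex_curve_in A \<gamma> P))"
  using assms by (rule total_curvature_le_and_eq_iff)

end
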